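(* Let $G$ be a maximal outerplanar graph of order $n \ge 5$ and let $n_2$ be the number of vertices of $G$ of degree $2$. Then $\iota_1(G) \le \frac{n+n_2}{6}$ if $n_2 \le \frac{n}{3}$, and $\iota_1(G) \le \frac{n-n_2}{3}$ otherwise.
   Context: A maximal outerplanar graph (mop) is a simple graph that can be embedded in the plane so that all vertices lie on the boundary of the exterior (unbounded) face and every interior face is a triangle. For a graph $G$ and $S \subseteq V(G)$, $N_G[S]$ denotes the closed neighborhood of $S$ (the vertices of $S$ together with all vertices adjacent to some vertex of $S$). A set $S \subseteq V(G)$ is a $K_{1,2}$-isolating set of $G$ if $G - N_G[S]$ contains no copy of $K_{1,2}$ (i.e. no path on three vertices as a subgraph), equivalently every component of $G - N_G[S]$ has at most two vertices. $\iota_1(G)$ denotes the minimum size of a $K_{1,2}$-isolating set of $G$.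
   Formalization: A maximal outerplanar graph is additionally required to be connected without a cut vertex; the embedding description alone also admits the path on five vertices, where n = 5, n_2 = 3 and ι_1 = 1 exceeds (n − n_2)/3 = 2/3. *)

theory Defs
  imports "HOL-Analysis.Analysis"
begin

definition simple_graph :: "'a set \<Rightarrow> 'a set set \<Rightarrow> bool" where
  "simple_graph V E \<longleftrightarrow> finite V \<and> (\<forall>e\<in>E. e \<subseteq> V \<and> card e = 2)"

definition vertex_degree :: "'a set set \<Rightarrow> 'a \<Rightarrow> nat" where
  "vertex_degree E v = card {e \<in> E. v \<in> e}"

definition induced_edges :: "'a set set \<Rightarrow> 'a set \<Rightarrow> 'a set set" where
  "induced_edges E W = {e \<in> E. e \<subseteq> W}"

definition graph_connected :: "'a set \<Rightarrow> 'a set set \<Rightarrow> bool" where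
  "graph_connected V E \<longleftrightarrow> (\<forall>u\<in>V. \<forall>v\<in>V. (u, v) \<in> {(x, y). {x, y} \<in> E}\<^sup>*)"

definition biconnected :: "'a set \<Rightarrow> 'a set set \<Rightarrow> bool" where
  "biconnected V E \<longleftrightarrow> graph_connected V E \<and>
     (\<forall>x\<in>V. graph_connected (V - {x}) (induced_edges E (V - {x})))"

text \<open>The plane is \<^typ>\<open>complex\<close>. In a drawing, \<open>\<phi>\<close> places the vertices and \<open>\<gamma> e\<close> is the
  arc representing the edge \<open>e\<close>, in either orientation.\<close>

definition plane_embedding ::
    "'a set \<Rightarrow> 'a set set \<Rightarrow> ('a \<Rightarrow> complex) \<Rightarrow> ('a set \<Rightarrow> real \<Rightarrow> complex) \<Rightarrow> bool" where
  "plane_embedding V E \<phi> \<gamma> \<longleftrightarrow>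
     inj_on \<phi> V \<and>
     (\<forall>e\<in>E. arc (\<gamma> e) \<and> {pathstart (\<gamma> e), pathfinish (\<gamma> e)} = \<phi> ` e \<and>
             path_image (\<gamma> e) \<inter> \<phi> ` V = \<phi> ` e) \<and>
     (\<forall>e\<in>E. \<forall>f\<in>E. e \<noteq> f \<longrightarrow> path_image (\<gamma> e) \<inter> path_image (\<gamma> f) = \<phi> ` (e \<inter> f))"

definition drawing ::
    "'a set \<Rightarrow> 'a set set \<Rightarrow> ('a \<Rightarrow> complex) \<Rightarrow> ('a set \<Rightarrow> real \<Rightarrow> complex) \<Rightarrow> complex set" where
  "drawing V E \<phi> \<gamma> = \<phi> ` V \<union> (\<Union>e\<in>E. path_image (\<gamma> e))"

definition triangle_face ::
    "'a set set \<Rightarrow> ('a set \<Rightarrow> real \<Rightarrow> complex) \<Rightarrow> complex set \<Rightarrow> bool" where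
  "triangle_face E \<gamma> F \<longleftrightarrow>
     (\<exists>a b c. a \<noteq> b \<and> b \<noteq> c \<and> a \<noteq> c \<and> {a, b} \<in> E \<and> {b, c} \<in> E \<and> {a, c} \<in> E \<and>
        frontier F = path_image (\<gamma> {a, b}) \<union> path_image (\<gamma> {b, c}) \<union> path_image (\<gamma> {a, c}))"

text \<open>The faces of a drawing \<open>D\<close> are the components of \<open>- D\<close>; as \<open>D\<close> is compact, exactly one of
  them is unbounded, and it is \<open>outside D\<close>.

  Biconnectedness is part of the notion of a maximal outerplanar graph although it is often left
  implicit when these graphs are described by their embeddings: without it, every path (which has no
  interior face at all) and any two triangles sharing one vertex would qualify, while neither is
  edge-maximal among the outerplanar graphs. The graphs on one and two vertices count as biconnected
  here as long as they are connected.\<close>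

definition maximal_outerplanar :: "'a set \<Rightarrow> 'a set set \<Rightarrow> bool" where
  "maximal_outerplanar V E \<longleftrightarrow> simple_graph V E \<and> biconnected V E \<and>
     (\<exists>\<phi> \<gamma>. plane_embedding V E \<phi> \<gamma> \<and>
        \<phi> ` V \<subseteq> frontier (outside (drawing V E \<phi> \<gamma>)) \<and>
        (\<forall>F \<in> components (- drawing V E \<phi> \<gamma>). bounded F \<longrightarrow> triangle_face E \<gamma> F))"

definition closed_nbhd :: "'a set set \<Rightarrow> 'a set \<Rightarrow> 'a set" where
  "closed_nbhd E S = S \<union> {v. \<exists>u\<in>S. {u, v} \<in> E}"

definition contains_K12 :: "'a set \<Rightarrow> 'a set set \<Rightarrow> bool" where
  "contains_K12 V E \<longleftrightarrow>
     (\<exists>x\<in>V. \<exists>y\<in>V. \<exists>z\<in>V. x \<noteq> y \<and> y \<noteq> z \<and> x \<noteq> z \<and> {x, y} \<in> E \<and> {y, z} \<in> E)"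

definition K12_isolating :: "'a set \<Rightarrow> 'a set set \<Rightarrow> 'a set \<Rightarrow> bool" where
  "K12_isolating V E S \<longleftrightarrow> S \<subseteq> V \<and>
     \<not> contains_K12 (V - closed_nbhd E S) (induced_edges E (V - closed_nbhd E S))"

definition iota1 :: "'a set \<Rightarrow> 'a set set \<Rightarrow> nat" where
  "iota1 V E = (LEAST k. \<exists>S. K12_isolating V E S \<and> card S = k)"

end

theory Submission
  imports Defs
begin

text \<open>
  Along a fixed outer edge \<open>uv\<close> the graph decomposes recursively: the triangle on \<open>uv\<close> has an apex
  \<open>w\<close>, and what remains are two smaller graphs of the same kind, rooted at \<open>uw\<close> and \<open>wv\<close>.

  That such a decomposition exists comes from the Jordan curve theorem. No vertex lies inside a cycle,
  because every vertex is on the boundary of the outer face. Given a longest cycle and an ear attached to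
  it from outside, one of the two arcs of the cycle lies inside the cycle formed by the ear and the other
  arc, so it is a single edge and the ear can be substituted for it; hence a longest cycle is Hamiltonian.
  The same argument shows that every chord is drawn inside, and the bounded face at a cycle edge is a
  triangle whose third vertex splits the cycle.

  For the bound \<open>(n - n2) / 3\<close>, delete the vertices of degree 2 and 3-colour the rest: every colour class
  dominates all remaining vertices, and the deleted ones are independent. For \<open>(n + n2) / 6\<close>, record which
  conditions on the root vertices \<open>u\<close> and \<open>v\<close> a partial solution with \<open>k\<close> further vertices can satisfy,
  as a function of \<open>6 k\<close> compared with the number of non-root vertices plus the number of those of
  degree 2. Nine such profiles are closed under gluing along an apex. As both bounds hold
  for all \<open>n2\<close>, the case distinction only selects the smaller one.
\<close>

section \<open>Rooted maximal outerplanar graphs\<close>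

text \<open>One number per part cannot be carried through the recursion: an apex may be dominated
  from one side only, and a path on three vertices may run across it, so a cheap solution of one
  part can be useless next to the other. A profile therefore promises several partial solutions at
  once, all for the same \<open>k\<close> but with different behaviour at \<open>u\<close> and
  \<open>v\<close>, and the neighbouring part picks the one that suits it. What is traded is the
  slack \<open>m - 6 * k\<close>, in which one vertex is worth 6. Slack 10 is the largest in
  \<open>fits\<close>: by then both roots can be chosen, since \<open>6 * k + 12 \<le> m + 2\<close>
  and the two roots add 2 to the order of the graph. The less slack there is, the more a profile
  must offer without choosing both roots.\<close>

text \<open>In \<open>rooted_mop u v V E L\<close>, the set \<open>L\<close> collects the vertices of degree 2 other than \<open>u\<close> and \<open>v\<close>.\<close>
inductive rooted_mop :: "'a \<Rightarrow> 'a \<Rightarrow> 'a set \<Rightarrow> 'a set set \<Rightarrow> 'a set \<Rightarrow> bool" where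
  edge: "u \<noteq> v \<Longrightarrow> rooted_mop u v {u, v} {{u, v}} {}"
| glue: "rooted_mop u w V1 E1 L1 \<Longrightarrow> rooted_mop w v V2 E2 L2 \<Longrightarrow> V1 \<inter> V2 = {w} \<Longrightarrow>
    rooted_mop u v (V1 \<union> V2) (insert {u, v} (E1 \<union> E2))
      (if V1 = {u, w} \<and> V2 = {w, v} then {w} else L1 \<union> L2)"

lemma rooted_mop_basic:
  assumes "rooted_mop u v V E L"
  shows "u \<noteq> v \<and> u \<in> V \<and> v \<in> V \<and> finite V \<and> {u, v} \<in> E \<and> L \<subseteq> V - {u, v} \<and>
    (\<forall>e\<in>E. e \<subseteq> V \<and> card e = 2)"
  using assms
proof induction
  case (edge u v)
  then show ?case by auto
next
  case (glue u w V1 E1 L1 v V2 E2 L2)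
  then have "u \<noteq> v" by auto
  then show ?case using glue by (auto; blast)
qed

lemma rooted_mop_sym:
  "rooted_mop u v V E L \<Longrightarrow> rooted_mop v u V E L"
proof (induction rule: rooted_mop.induct)
  case (edge u v)
  then show ?case using rooted_mop.edge[of v u] by (simp add: insert_commute)
next
  case (glue u w V1 E1 L1 v V2 E2 L2)
  have "V2 \<inter> V1 = {w}" using glue.hyps by auto
  from rooted_mop.glue[OF glue.IH(2,1) this]
  have "rooted_mop v u (V1 \<union> V2) (insert {u, v} (E1 \<union> E2))
      (if V2 = {v, w} \<and> V1 = {w, u} then {w} else L1 \<union> L2)"
    by (simp only: insert_commute Un_commute)
  moreover have "V2 = {v, w} \<and> V1 = {w, u} \<longleftrightarrow> V1 = {u, w} \<and> V2 = {w, v}" by auto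
  ultimately show ?case by (simp only:)
qed

section \<open>Partial solutions and the statuses of the two roots\<close>

text \<open>The status of a root vertex with respect to a partial solution. A \<open>Deleted\<close> vertex is left out of the
  residual graph because it will be dominated from the other side of the root edge. An \<open>Isolated\<close> vertex, if
  residual, has no residual neighbour except possibly the other root; a \<open>Free\<close> vertex is merely not chosen.\<close>
datatype status = Chosen | Dominated | Deleted | Isolated | Free

text \<open>In a simple graph the ends of an edge differ, so \<open>x = z\<close> is the only
  coincidence that keeps two consecutive edges from forming a path on three vertices.\<close>

definition K12_free :: "'a set set \<Rightarrow> 'a set \<Rightarrow> bool" where
  "K12_free E R \<longleftrightarrow> (\<forall>x\<in>R. \<forall>y\<in>R. \<forall>z\<in>R. {x, y} \<in> E \<longrightarrow> {y, z} \<in> E \<longrightarrow> x = z)"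

definition residual where
  "residual V E u v a b X = V - closed_nbhd E X -
     (if a = Deleted then {u} else {}) - (if b = Deleted then {v} else {})"

fun status_ok :: "'a set set \<Rightarrow> 'a set \<Rightarrow> 'a set \<Rightarrow> 'a set \<Rightarrow> 'a \<Rightarrow> 'a \<Rightarrow> status \<Rightarrow> bool" where
  "status_ok E N X R u v Chosen \<longleftrightarrow> u \<in> X"
| "status_ok E N X R u v Dominated \<longleftrightarrow> u \<notin> X \<and> u \<in> N"
| "status_ok E N X R u v Isolated \<longleftrightarrow> u \<notin> X \<and> (u \<in> R \<longrightarrow> (\<forall>y\<in>R. {u, y} \<in> E \<longrightarrow> y = v))"
| "status_ok E N X R u v _ \<longleftrightarrow> u \<notin> X"

definition partial_iso where
  "partial_iso V E u v a b X \<longleftrightarrow> X \<subseteq> V \<and> K12_free E (residual V E u v a b X) \<and>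
     status_ok E (closed_nbhd E X) X (residual V E u v a b X) u v a \<and> status_ok E (closed_nbhd E X) X (residual V E u v a b X) v u b"

definition attains where
  "attains V E u v k a b \<longleftrightarrow> (\<exists>X. partial_iso V E u v a b X \<and> card (X - {u, v}) \<le> k)"

text \<open>The order in which one status implies another for the same set: a dominated root is not
  residual, hence vacuously isolated, and deleting a root only shrinks the residual graph.
  \<open>Deleted\<close> implies nothing else, as restoring the root could create a path.\<close>

definition weaker :: "status \<Rightarrow> status \<Rightarrow> bool" where
  "weaker a b \<longleftrightarrow> a = b \<or> (a = Dominated \<and> b \<noteq> Chosen) \<or>
    (a = Isolated \<and> b \<in> {Deleted, Free}) \<or> (a = Free \<and> b = Deleted)"

lemma residual_weaker:
  assumes "weaker a a'" "weaker b b'" "status_ok E (closed_nbhd E X) X R' u v a" "status_ok E (closed_nbhd E X) X R'' v u b"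
  shows "residual V E u v a' b' X \<subseteq> residual V E u v a b X"
  using assms by (auto simp: residual_def weaker_def)

lemma partial_iso_weaker:
  assumes "partial_iso V E u v a b X" "weaker a a'" "weaker b b'"
  shows "partial_iso V E u v a' b' X"
proof -
  let ?R = "residual V E u v a b X" and ?R' = "residual V E u v a' b' X"
  have st: "status_ok E (closed_nbhd E X) X ?R u v a" "status_ok E (closed_nbhd E X) X ?R v u b" and k: "K12_free E ?R" "X \<subseteq> V"
    using assms(1) by (auto simp: partial_iso_def)
  have sub: "?R' \<subseteq> ?R" using residual_weaker[OF assms(2,3) st] .
  have "K12_free E ?R'" using k sub unfolding K12_free_def by (meson subsetD)
  moreover have "status_ok E (closed_nbhd E X) X ?R' x y s'" if "status_ok E (closed_nbhd E X) X ?R x y s" "weaker s s'" for x y s s'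
  proof (cases "s = Dominated")
    case True
    then have "x \<notin> ?R'" "x \<notin> X" "x \<in> closed_nbhd E X" using that by (auto simp: residual_def)
    then show ?thesis using that(2) True by (cases s') (auto simp: weaker_def)
  next
    case False
    then show ?thesis using that sub by (cases s; cases s') (auto simp: weaker_def)
  qed
  ultimately show ?thesis using st assms(2,3) k by (auto simp: partial_iso_def)
qed

lemma attains_weaker:
  "attains V E u v k a b \<Longrightarrow> weaker a a' \<Longrightarrow> weaker b b' \<Longrightarrow> k \<le> k' \<Longrightarrow> attains V E u v k' a' b'"
  unfolding attains_def using partial_iso_weaker by (meson order_trans)

definition covers :: "status \<Rightarrow> bool" where
  "covers s \<longleftrightarrow> s = Chosen \<or> s = Dominated"

text \<open>\<open>passes a d c a'\<close>: a root of status \<open>a\<close> in its part has status \<open>a'\<close> in the glued graph, where \<open>d\<close> is the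
  status of the other root and \<open>c\<close> says whether the apex is dominated.\<close>
fun passes :: "status \<Rightarrow> status \<Rightarrow> bool \<Rightarrow> status \<Rightarrow> bool" where
  "passes a d c Chosen \<longleftrightarrow> a = Chosen"
| "passes a d c Dominated \<longleftrightarrow> a = Dominated \<or> a \<noteq> Chosen \<and> d = Chosen"
| "passes a d c Deleted \<longleftrightarrow> a \<noteq> Chosen"
| "passes a d c Isolated \<longleftrightarrow> a = Dominated \<or> a = Isolated \<and> c"
| "passes a d c Free \<longleftrightarrow> a \<noteq> Chosen \<and> a \<noteq> Deleted"

text \<open>\<open>a b\<close> are the statuses of \<open>u w\<close> in the first part and \<open>c d\<close> those of \<open>w v\<close> in the second.\<close>
definition joinable :: "status \<Rightarrow> status \<Rightarrow> status \<Rightarrow> status \<Rightarrow> status \<Rightarrow> status \<Rightarrow> bool" where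
  "joinable a b c d a' b' \<longleftrightarrow> (b = Chosen \<longleftrightarrow> c = Chosen) \<and>
    (b = Deleted \<longrightarrow> c = Dominated) \<and> (c = Deleted \<longrightarrow> b = Dominated) \<and>
    (covers b \<or> covers c \<or> b = Isolated \<and> (covers a \<or> a = Deleted) \<or> c = Isolated \<and> (covers d \<or> d = Deleted)) \<and>
    (covers a \<or> a = Deleted \<or> covers d \<or> d = Deleted \<or> a = Isolated \<and> d = Isolated \<and> (covers b \<or> covers c)) \<and>
    passes a d (covers b \<or> covers c) a' \<and> passes d a (covers b \<or> covers c) b'"

section \<open>Gluing two rooted graphs at an apex\<close>

locale gluing =
  fixes u v w :: 'a and V1 V2 :: "'a set" and E1 E2 :: "'a set set" and L1 L2 :: "'a set"
  assumes mop1: "rooted_mop u w V1 E1 L1" and mop2: "rooted_mop w v V2 E2 L2"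
    and meet: "V1 \<inter> V2 = {w}"
begin

definition "V = V1 \<union> V2"
definition "E = insert {u, v} (E1 \<union> E2)"

lemma vertices: "u \<noteq> v" "u \<noteq> w" "v \<noteq> w" "u \<in> V1" "w \<in> V1" "w \<in> V2" "v \<in> V2" "u \<notin> V2" "v \<notin> V1"
  "finite V1" "finite V2"
  using rooted_mop_basic[OF mop1] rooted_mop_basic[OF mop2] meet by auto

lemma E1_sub: "{x, y} \<in> E1 \<Longrightarrow> x \<in> V1 \<and> y \<in> V1 \<and> x \<noteq> y"
  using rooted_mop_basic[OF mop1] by (auto dest!: bspec)

lemma E2_sub: "{x, y} \<in> E2 \<Longrightarrow> x \<in> V2 \<and> y \<in> V2 \<and> x \<noteq> y"
  using rooted_mop_basic[OF mop2] by (auto dest!: bspec)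

lemma E1_edge: "e \<in> E1 \<Longrightarrow> e \<subseteq> V1" "e \<in> E1 \<Longrightarrow> card e = 2"
  and E2_edge: "e \<in> E2 \<Longrightarrow> e \<subseteq> V2" "e \<in> E2 \<Longrightarrow> card e = 2"
  using rooted_mop_basic[OF mop1] rooted_mop_basic[OF mop2] by auto

lemma finite_E: "finite E1" "finite E2"
  using finite_subset[of E1 "Pow V1"] finite_subset[of E2 "Pow V2"] E1_edge(1) E2_edge(1) vertices(10,11)
  by auto

lemma E1_E2_disjoint: "E1 \<inter> E2 = {}"
proof (rule ccontr)
  assume "E1 \<inter> E2 \<noteq> {}"
  then obtain e where e: "e \<in> E1" "e \<in> E2" by blast
  then have "e \<subseteq> {w}" using E1_edge(1) E2_edge(1) meet by blast
  then have "card e \<le> card {w}" by (intro card_mono) auto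
  then show False using E1_edge(2)[OF e(1)] by simp
qed

lemma uv_notin: "{u, v} \<notin> E1" "{u, v} \<notin> E2"
  using E1_edge(1) E2_edge(1) vertices by auto

lemma degree_interior1:
  assumes "x \<in> V1 - {u, w}" shows "vertex_degree E x = vertex_degree E1 x"
proof -
  have "x \<notin> V2" "x \<noteq> u" "x \<noteq> v" using assms vertices meet by auto
  then have "{e \<in> E. x \<in> e} = {e \<in> E1. x \<in> e}" using E2_edge(1) unfolding E_def by auto
  then show ?thesis by (simp add: vertex_degree_def)
qed

lemma degree_interior2:
  assumes "x \<in> V2 - {w, v}" shows "vertex_degree E x = vertex_degree E2 x"
proof -
  have "x \<notin> V1" "x \<noteq> u" "x \<noteq> v" using assms vertices meet by auto
  then have "{e \<in> E. x \<in> e} = {e \<in> E2. x \<in> e}" using E1_edge(1) unfolding E_def by auto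
  then show ?thesis by (simp add: vertex_degree_def)
qed

lemma degree_apex: "vertex_degree E w = vertex_degree E1 w + vertex_degree E2 w"
proof -
  have "{e \<in> E. w \<in> e} = {e \<in> E1. w \<in> e} \<union> {e \<in> E2. w \<in> e}" using vertices unfolding E_def by auto
  moreover have "{e \<in> E1. w \<in> e} \<inter> {e \<in> E2. w \<in> e} = {}" using E1_E2_disjoint by blast
  ultimately show ?thesis unfolding vertex_degree_def using finite_E by (simp add: card_Un_disjoint)
qed

lemma degree_root: "vertex_degree E u = Suc (vertex_degree E1 u)" "vertex_degree E v = Suc (vertex_degree E2 v)"
proof -
  have "{e \<in> E. u \<in> e} = insert {u, v} {e \<in> E1. u \<in> e}"
    using E2_edge(1) vertices(8) unfolding E_def by auto
  then show "vertex_degree E u = Suc (vertex_degree E1 u)"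
    unfolding vertex_degree_def using finite_E uv_notin by simp
  have "{e \<in> E. v \<in> e} = insert {u, v} {e \<in> E2. v \<in> e}"
    using E1_edge(1) vertices(9) unfolding E_def by auto
  then show "vertex_degree E v = Suc (vertex_degree E2 v)"
    unfolding vertex_degree_def using finite_E uv_notin by simp
qed

lemma V_cases: "x \<in> V \<Longrightarrow> x = u \<or> x = v \<or> x = w \<or> x \<in> V1 - {u, w} \<or> x \<in> V2 - {w, v}"
  unfolding V_def by auto

lemma L_sub: "L1 \<subseteq> V1 - {u, w}" "L2 \<subseteq> V2 - {w, v}"
  using rooted_mop_basic[OF mop1] rooted_mop_basic[OF mop2] by auto

lemma interior_disjoint: "x \<in> V1 - {u, w} \<Longrightarrow> x \<notin> V2" "x \<in> V2 - {w, v} \<Longrightarrow> x \<notin> V1"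
  using meet by auto

lemma card_interior: "card (V - {u, v}) = Suc (card (V1 - {u, w}) + card (V2 - {w, v}))"
proof -
  have V: "V - {u, v} = insert w ((V1 - {u, w}) \<union> (V2 - {w, v}))"
    unfolding V_def using vertices(1-9) by blast
  have "(V1 - {u, w}) \<inter> (V2 - {w, v}) = {}" using meet by blast
  then show ?thesis unfolding V using vertices(10,11) by (simp add: card_Un_disjoint)
qed

lemma card_L: "card (L1 \<union> L2) = card L1 + card L2"
proof (rule card_Un_disjoint)
  show "finite L1" "finite L2" using L_sub vertices(10,11) finite_subset by blast+
  show "L1 \<inter> L2 = {}" using L_sub interior_disjoint by blast
qed

lemma nbhd_mono: "closed_nbhd E1 X1 \<union> closed_nbhd E2 X2 \<subseteq> closed_nbhd E (X1 \<union> X2)"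
  unfolding closed_nbhd_def E_def by blast

lemma nbhd_root: "u \<in> X \<Longrightarrow> v \<in> closed_nbhd E X" "v \<in> X \<Longrightarrow> u \<in> closed_nbhd E X"
  unfolding closed_nbhd_def E_def by (auto simp: insert_commute)

text \<open>A path on three vertices that lies in neither part either has its two edges in different
  parts, and then its centre is \<open>w\<close>, or uses the new edge \<open>{u, v}\<close>, and
  then its centre is \<open>u\<close> or \<open>v\<close>. The last two hypotheses exclude these two
  kinds.\<close>

lemma K12_free_glue:
  assumes "K12_free E1 R1" "K12_free E2 R2" "R \<subseteq> V" "R \<inter> V1 \<subseteq> R1" "R \<inter> V2 \<subseteq> R2"
    and w: "\<And>x y. w \<in> R \<Longrightarrow> x \<in> R \<Longrightarrow> y \<in> R \<Longrightarrow> {x, w} \<in> E1 \<Longrightarrow> {w, y} \<in> E2 \<Longrightarrow> False"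
    and uv: "\<And>x. u \<in> R \<Longrightarrow> v \<in> R \<Longrightarrow> x \<in> R \<Longrightarrow> {x, u} \<in> E1 \<or> {x, v} \<in> E2 \<Longrightarrow> False"
  shows "K12_free E R"
  unfolding K12_free_def
proof (intro ballI impI)
  fix x y z assume R: "x \<in> R" "y \<in> R" "z \<in> R" and e: "{x, y} \<in> E" "{y, z} \<in> E"
  have c1: "x = z" if "{x, y} \<in> E1" "{y, z} \<in> E1"
    using assms(1,4) R E1_sub[OF that(1)] E1_sub[OF that(2)] that unfolding K12_free_def by blast
  have c2: "x = z" if "{x, y} \<in> E2" "{y, z} \<in> E2"
    using assms(2,5) R E2_sub[OF that(1)] E2_sub[OF that(2)] that unfolding K12_free_def by blast
  have c3: "False" if "{a, y} \<in> E1" "{y, b} \<in> E2" "a \<in> R" "b \<in> R" for a b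
  proof -
    have "y = w" using E1_sub[OF that(1)] E2_sub[OF that(2)] meet by blast
    then show False using w R that by blast
  qed
  have c4: "False" if "{a, y} = {u, v}" "{b, y} \<in> E1 \<union> E2" "a \<in> R" "b \<in> R" for a b
    using that uv[of b] R E1_sub[of b y] E2_sub[of b y] vertices by (auto simp: doubleton_eq_iff)
  consider "{x, y} = {u, v}" "{y, z} = {u, v}" | "{x, y} = {u, v}" "{z, y} \<in> E1 \<union> E2" |
    "{z, y} = {u, v}" "{x, y} \<in> E1 \<union> E2" | "{x, y} \<in> E1 \<union> E2" "{y, z} \<in> E1 \<union> E2"
    using e unfolding E_def by (auto simp: insert_commute)
  then show "x = z"
  proof cases
    case 1 then show ?thesis by (metis doubleton_eq_iff)
  next
    case 2 then show ?thesis using c4 R by blast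
  next
    case 3 then show ?thesis using c4 R by blast
  next
    case 4 then show ?thesis using c1 c2 c3[of x z] c3[of z x] R by (auto simp: insert_commute)
  qed
qed

text \<open>The apex is a root of both parts and hence counted in neither; as a non-root of the
  glued graph it has to be paid for here.\<close>

lemma card_glue:
  assumes "X1 \<subseteq> V1" "X2 \<subseteq> V2"
  shows "card (X1 \<union> X2 - {u, v}) \<le> card (X1 - {u, w}) + card (X2 - {w, v}) + (if w \<in> X1 \<union> X2 then 1 else 0)"
proof -
  have fin: "finite X1" "finite X2" using assms vertices finite_subset by blast+
  have "X1 \<union> X2 - {u, v} \<subseteq> (X1 - {u, w}) \<union> (X2 - {w, v}) \<union> ({w} \<inter> (X1 \<union> X2))" by auto
  then have "card (X1 \<union> X2 - {u, v}) \<le> card ((X1 - {u, w}) \<union> (X2 - {w, v}) \<union> ({w} \<inter> (X1 \<union> X2)))"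
    using fin by (intro card_mono) auto
  also have "\<dots> \<le> card (X1 - {u, w}) + card (X2 - {w, v}) + card ({w} \<inter> (X1 \<union> X2))"
    by (intro order_trans[OF card_Un_le] add_mono card_Un_le) auto
  finally show ?thesis by (auto split: if_splits)
qed

abbreviation "P1 \<equiv> attains V1 E1 u w"
abbreviation "P2 \<equiv> attains V2 E2 w v"
abbreviation "P \<equiv> attains V E u v"

lemma E_cases:
  "{u, y} \<in> E \<longleftrightarrow> y = v \<or> {u, y} \<in> E1" "{v, y} \<in> E \<longleftrightarrow> y = u \<or> {v, y} \<in> E2"
  using vertices E1_sub[of v y] E2_sub[of u y] unfolding E_def by (auto simp: doubleton_eq_iff)

text \<open>A residual path across \<open>w\<close> is impossible if \<open>w\<close> is dominated,
  or if in one part its only possible residual neighbour is the other root and that root is not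
  residual. A residual path through \<open>{u, v}\<close> is impossible if one of the two is not
  residual, or if within their parts both have no residual neighbour except \<open>w\<close> and
  \<open>w\<close> is dominated. These are the two disjunctions in \<open>joinable\<close>.\<close>

lemma partial_iso_glue:
  assumes p1: "partial_iso V1 E1 u w a b X1" and p2: "partial_iso V2 E2 w v c d X2"
    and J: "joinable a b c d a' b'"
  shows "partial_iso V E u v a' b' (X1 \<union> X2)"
proof -
  define R1 R2 R where R: "R1 = residual V1 E1 u w a b X1" "R2 = residual V2 E2 w v c d X2"
    "R = residual V E u v a' b' (X1 \<union> X2)"
  define N1 N2 N where N: "N1 = closed_nbhd E1 X1" "N2 = closed_nbhd E2 X2"
    "N = closed_nbhd E (X1 \<union> X2)"
  have RV: "R \<subseteq> V" unfolding R residual_def by auto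
  have X: "X1 \<subseteq> V1" "X2 \<subseteq> V2" and K: "K12_free E1 R1" "K12_free E2 R2"
    and st: "status_ok E1 N1 X1 R1 u w a" "status_ok E1 N1 X1 R1 w u b"
      "status_ok E2 N2 X2 R2 w v c" "status_ok E2 N2 X2 R2 v w d"
    using p1 p2 by (auto simp: partial_iso_def R N)
  have NN: "X1 \<subseteq> N1" "X2 \<subseteq> N2" "N1 \<subseteq> N" "N2 \<subseteq> N" "u \<in> X1 \<Longrightarrow> v \<in> N" "v \<in> X2 \<Longrightarrow> u \<in> N"
    unfolding N using nbhd_mono[of X1 X2] nbhd_root[of "X1 \<union> X2"] by (auto simp: closed_nbhd_def)
  have covered: "x \<in> M" if "status_ok F M X S x y s" "covers s" "X \<subseteq> M" for F M X S x y s
    using that by (cases s) (auto simp: covers_def)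
  have wN: "w \<in> N" if "covers b \<or> covers c"
    using that covered[OF st(2)] covered[OF st(3)] NN by blast
  have uN: "u \<in> N" if "covers a" using covered[OF st(1) that] NN by blast
  have vN: "v \<in> N" if "covers d" using covered[OF st(4) that] NN by blast
  have RN: "x \<notin> R" if "x \<in> N" for x using that unfolding R N residual_def by auto
  have uX: "u \<in> X1 \<longleftrightarrow> a = Chosen" using st(1) by (cases a) auto
  have vX: "v \<in> X2 \<longleftrightarrow> d = Chosen" using st(4) by (cases d) auto
  have uX': "u \<in> X1 \<union> X2 \<longleftrightarrow> a = Chosen" using uX X vertices by auto
  have vX': "v \<in> X1 \<union> X2 \<longleftrightarrow> d = Chosen" using vX X vertices by auto
  \<comment> \<open>\<open>passes\<close> lets a deleted root either stay deleted or become
    dominated by the other root, which is then chosen.\<close>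
  have u_del: "u \<notin> R" if "a = Deleted"
  proof (cases "a' = Deleted")
    case True then show ?thesis by (auto simp: R residual_def)
  next
    case False
    then have "d = Chosen" using J that by (cases a') (auto simp: joinable_def covers_def)
    then show ?thesis using NN vX RN by auto
  qed
  have v_del: "v \<notin> R" if "d = Deleted"
  proof (cases "b' = Deleted")
    case True then show ?thesis by (auto simp: R residual_def)
  next
    case False
    then have "a = Chosen" using J that by (cases b') (auto simp: joinable_def covers_def)
    then show ?thesis using NN uX RN by auto
  qed
  \<comment> \<open>The apex may be deleted in one part only if the other part dominates it.\<close>
  have w_del: "w \<notin> R" if "b = Deleted \<or> c = Deleted"
    using J that wN RN by (auto simp: joinable_def covers_def)
  have R1: "R \<inter> V1 \<subseteq> R1"
    using u_del w_del NN(3) RN unfolding R(1) residual_def N[symmetric] by auto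
  have R2: "R \<inter> V2 \<subseteq> R2"
    using v_del w_del NN(4) RN unfolding R(2) residual_def N[symmetric] by auto
  have iso1: "x = u" if "b = Isolated" "w \<in> R" "x \<in> R" "{w, x} \<in> E1" for x
    using st(2) that R1 E1_sub[OF that(4)] by auto
  have iso2: "x = v" if "c = Isolated" "w \<in> R" "x \<in> R" "{w, x} \<in> E2" for x
    using st(3) that R2 E2_sub[OF that(4)] by auto
  have iso3: "x = w" if "a = Isolated" "u \<in> R" "x \<in> R" "{u, x} \<in> E1" for x
    using st(1) that R1 E1_sub[OF that(4)] by auto
  have iso4: "x = w" if "d = Isolated" "v \<in> R" "x \<in> R" "{v, x} \<in> E2" for x
    using st(4) that R2 E2_sub[OF that(4)] by auto
  have "K12_free E R"
  proof (rule K12_free_glue[OF K RV R1 R2])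
    fix x y assume *: "w \<in> R" "x \<in> R" "y \<in> R" "{x, w} \<in> E1" "{w, y} \<in> E2"
    then have "\<not> covers b" "\<not> covers c" using wN RN by auto
    then have "b = Isolated \<and> (covers a \<or> a = Deleted) \<or> c = Isolated \<and> (covers d \<or> d = Deleted)"
      using J by (simp add: joinable_def)
    then show False using iso1[of x] iso2[of y] * uN vN RN u_del v_del by (auto simp: insert_commute)
  next
    fix x assume *: "u \<in> R" "v \<in> R" "x \<in> R" "{x, u} \<in> E1 \<or> {x, v} \<in> E2"
    then have "\<not> (covers a \<or> a = Deleted)" "\<not> (covers d \<or> d = Deleted)"
      using uN vN RN u_del v_del by auto
    then have "a = Isolated" "d = Isolated" "covers b \<or> covers c" using J by (auto simp: joinable_def)
    then show False using iso3[of x] iso4[of x] * wN RN by (auto simp: insert_commute)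
  qed
  moreover have "status_ok E N (X1 \<union> X2) R u v a'"
  proof (cases a')
    case Isolated
    then have "a = Dominated \<or> a = Isolated \<and> (covers b \<or> covers c)" using J
      by (simp add: joinable_def)
    then show ?thesis using Isolated iso3 uX' uN wN RN by (auto simp: E_cases covers_def)
  qed (use J uX' uN NN(6) vX in \<open>auto simp: joinable_def covers_def\<close>)
  moreover have "status_ok E N (X1 \<union> X2) R v u b'"
  proof (cases b')
    case Isolated
    then have "d = Dominated \<or> d = Isolated \<and> (covers b \<or> covers c)" using J
      by (simp add: joinable_def)
    then show ?thesis using Isolated iso4 vX' vN wN RN by (auto simp: E_cases covers_def)
  qed (use J vX' vN NN(5) uX in \<open>auto simp: joinable_def covers_def\<close>)
  ultimately show ?thesis using X unfolding partial_iso_def R N V_def by blast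
qed

lemma attains_glue:
  assumes "P1 k a b" "P2 l c d" "joinable a b c d a' b'" "k + l + (if b = Chosen then 1 else 0) \<le> n"
  shows "P n a' b'"
proof -
  obtain X1 X2 where X: "partial_iso V1 E1 u w a b X1" "card (X1 - {u, w}) \<le> k"
    "partial_iso V2 E2 w v c d X2" "card (X2 - {w, v}) \<le> l"
    using assms by (auto simp: attains_def)
  have w: "w \<in> X1 \<union> X2 \<longleftrightarrow> b = Chosen" using X assms(3)
    by (cases b; cases c) (auto simp: partial_iso_def joinable_def)
  have "X1 \<subseteq> V1" "X2 \<subseteq> V2" using X by (auto simp: partial_iso_def)
  then have "card (X1 \<union> X2 - {u, v}) \<le> n"
    using card_glue[of X1 X2] X w assms(4) by auto
  then show ?thesis using partial_iso_glue[OF X(1,3) assms(3)] unfolding attains_def by blast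
qed

end

section \<open>Profiles of rooted graphs\<close>

text \<open>Here \<open>m\<close> is the number of non-root vertices plus the number of those of degree 2. The disjuncts are the
  worst profiles that occur; they were found by closing the profile of a single edge under gluing and then
  weakening the results until finitely many were left.\<close>
definition fits :: "(nat \<Rightarrow> status \<Rightarrow> status \<Rightarrow> bool) \<Rightarrow> nat \<Rightarrow> nat \<Rightarrow> bool" where
  "fits A m k \<longleftrightarrow> A k Chosen Chosen \<and>
    (6 * k + 10 \<le> m \<or>
     6 * k + 5 \<le> m \<and> A k Chosen Dominated \<or>
     6 * k + 5 \<le> m \<and> A k Dominated Chosen \<or>
     A k Chosen Dominated \<and> A k Dominated Chosen \<and>
     (6 * k + 4 \<le> m \<or>
      6 * k + 3 \<le> m \<and> A k Deleted Deleted \<or>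
      6 * k + 2 \<le> m \<and> A k Deleted Free \<and> A k Free Deleted \<or>
      6 * k + 1 \<le> m \<and> A k Dominated Isolated \<or>
      6 * k + 1 \<le> m \<and> A k Isolated Dominated \<or>
      6 * k \<le> m \<and> A k Dominated Dominated))"

text \<open>A single edge needs a profile of its own: it has \<open>m = 0\<close>, and the only
  disjunct of \<open>fits\<close> that allows this asks for two dominated roots with neither chosen,
  but an edge has no further vertex to dominate them.\<close>

definition fits_edge :: "(nat \<Rightarrow> status \<Rightarrow> status \<Rightarrow> bool) \<Rightarrow> bool" where
  "fits_edge A \<longleftrightarrow> A 0 Chosen Chosen \<and> A 0 Chosen Dominated \<and> A 0 Dominated Chosen \<and> A 0 Isolated Isolated"

text \<open>The cases spell out what each profile implies by \<open>weaker\<close>, so that gluing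
  two profiles becomes a finite lookup among facts of the form \<open>A k a b\<close>.\<close>

lemma fits_cases:
  assumes "fits A m k" and A: "A = attains V E u v"
  obtains
    "6 * k + 10 \<le> m" "A k Chosen Chosen" |
    "6 * k + 5 \<le> m" "A k Chosen Chosen" "A k Chosen Dominated" |
    "6 * k + 5 \<le> m" "A k Chosen Chosen" "A k Dominated Chosen" |
    "6 * k + 4 \<le> m" "A k Chosen Chosen" "A k Chosen Dominated" "A k Dominated Chosen" |
    "6 * k + 3 \<le> m" "A k Chosen Chosen" "A k Chosen Dominated" "A k Dominated Chosen"
      "A k Deleted Deleted" |
    "6 * k + 2 \<le> m" "A k Chosen Chosen" "A k Chosen Dominated" "A k Dominated Chosen"
      "A k Deleted Free" "A k Free Deleted" "A k Deleted Deleted" |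
    "6 * k + 1 \<le> m" "A k Chosen Chosen" "A k Chosen Dominated" "A k Dominated Chosen"
      "A k Dominated Isolated" "A k Deleted Deleted" "A k Isolated Deleted" "A k Deleted Isolated"
      "A k Isolated Isolated" "A k Free Deleted" "A k Deleted Free" |
    "6 * k + 1 \<le> m" "A k Chosen Chosen" "A k Chosen Dominated" "A k Dominated Chosen"
      "A k Isolated Dominated" "A k Deleted Deleted" "A k Isolated Deleted" "A k Deleted Isolated"
      "A k Isolated Isolated" "A k Free Deleted" "A k Deleted Free" |
    "6 * k \<le> m" "A k Chosen Chosen" "A k Chosen Dominated" "A k Dominated Chosen"
      "A k Dominated Dominated" "A k Deleted Deleted" "A k Isolated Deleted" "A k Deleted Isolated"
      "A k Isolated Isolated" "A k Free Deleted" "A k Deleted Free" "A k Dominated Isolated"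
      "A k Isolated Dominated"
proof -
  have w: "A k Dominated b \<Longrightarrow> A k Isolated b" "A k Isolated b \<Longrightarrow> A k Free b" "A k Free b \<Longrightarrow> A k Deleted b"
    "A k b Dominated \<Longrightarrow> A k b Isolated" "A k b Isolated \<Longrightarrow> A k b Free" "A k b Free \<Longrightarrow> A k b Deleted" for b
    unfolding A by (erule attains_weaker; simp add: weaker_def)+
  show ?thesis
    using assms(1) unfolding fits_def
    apply (elim conjE disjE)
    subgoal by (rule that(1); (assumption | blast intro: w))
    subgoal by (rule that(2); (assumption | blast intro: w))
    subgoal by (rule that(3); (assumption | blast intro: w))
    subgoal by (rule that(4); (assumption | blast intro: w))
    subgoal by (rule that(5); (assumption | blast intro: w))
    subgoal by (rule that(6); (assumption | blast intro: w))
    subgoal by (rule that(7); (assumption | blast intro: w))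
    subgoal by (rule that(8); (assumption | blast intro: w))
    subgoal by (rule that(9); (assumption | blast intro: w))
    done
qed

text \<open>Here \<open>m\<close> stands for \<open>n + n2\<close> of the whole graph. As
  \<open>k\<close> does not count the roots, each chosen root adds 6 to the price. Nothing lies
  beyond the root edge any more, so a deleted root would be of no use.\<close>

definition finishes :: "(nat \<Rightarrow> status \<Rightarrow> status \<Rightarrow> bool) \<Rightarrow> nat \<Rightarrow> nat \<Rightarrow> bool" where
  "finishes A m k \<longleftrightarrow> 6 * k \<le> m \<and> A k Free Free \<or>
     6 * k + 6 \<le> m \<and> (A k Chosen Dominated \<or> A k Dominated Chosen) \<or> 6 * k + 12 \<le> m \<and> A k Chosen Chosen"

lemma fits_edge_cases:
  assumes "fits_edge A" and A: "A = attains V E u v"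
  obtains "A 0 Chosen Chosen" "A 0 Chosen Dominated" "A 0 Dominated Chosen" "A 0 Isolated Isolated"
    "A 0 Deleted Deleted" "A 0 Isolated Deleted" "A 0 Deleted Isolated" "A 0 Deleted Free" "A 0 Free Deleted"
proof -
  have "A 0 a b" if "weaker Isolated a" "weaker Isolated b" for a b
    using assms(1) attains_weaker[of V E u v 0 Isolated Isolated a b 0] that by (simp add: A fits_edge_def)
  then show ?thesis using that assms(1) by (simp add: weaker_def fits_edge_def)
qed

lemma edge_fits:
  assumes "u \<noteq> v" shows "fits_edge (attains {u, v} {{u, v}} u v)"
proof -
  have a: "attains {u, v} {{u, v}} u v 0 a b" if "partial_iso {u, v} {{u, v}} u v a b X" for a b X
  proof -
    have "X - {u, v} = {}" using that by (auto simp: partial_iso_def)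
    then show ?thesis using that unfolding attains_def by (metis card.empty le0)
  qed
  \<comment> \<open>The witnesses are the four subsets of \<open>{u, v}\<close>; the empty one
    leaves the edge itself as a residual component, so both ends are isolated.\<close>
  show ?thesis unfolding fits_edge_def
    using assms a[of _ _ "{u, v}"] a[of _ _ "{u}"] a[of _ _ "{v}"] a[of _ _ "{}"]
    by (simp add: partial_iso_def residual_def closed_nbhd_def K12_free_def doubleton_eq_iff)
qed

context gluing
begin

text \<open>The instances of \<open>attains_glue\<close> that the profiles call for; the successor
  stands exactly where both parts have chosen the apex.\<close>

lemma glue_rules:
  "P1 k Chosen Chosen \<Longrightarrow> P2 l Chosen Chosen \<Longrightarrow> P (Suc (k + l)) Chosen Chosen"
  "P1 k Chosen Dominated \<Longrightarrow> P2 l Dominated Chosen \<Longrightarrow> P (k + l) Chosen Chosen"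
  "P1 k Chosen Chosen \<Longrightarrow> P2 l Chosen Dominated \<Longrightarrow> P (Suc (k + l)) Chosen Dominated"
  "P1 k Chosen Dominated \<Longrightarrow> P2 l Deleted Deleted \<Longrightarrow> P (k + l) Chosen Dominated"
  "P1 k Dominated Chosen \<Longrightarrow> P2 l Chosen Chosen \<Longrightarrow> P (Suc (k + l)) Dominated Chosen"
  "P1 k Deleted Deleted \<Longrightarrow> P2 l Dominated Chosen \<Longrightarrow> P (k + l) Dominated Chosen"
  "P1 k Dominated Chosen \<Longrightarrow> P2 l Chosen Dominated \<Longrightarrow> P (Suc (k + l)) Dominated Dominated"
  "P1 k Dominated Chosen \<Longrightarrow> P2 l Chosen Dominated \<Longrightarrow> P (Suc (k + l)) Free Free"
  "P1 k Isolated Deleted \<Longrightarrow> P2 l Dominated Dominated \<Longrightarrow> P (k + l) Isolated Dominated"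
  "P1 k Dominated Dominated \<Longrightarrow> P2 l Deleted Isolated \<Longrightarrow> P (k + l) Dominated Isolated"
  "P1 k Isolated Isolated \<Longrightarrow> P2 l Isolated Deleted \<Longrightarrow> P (k + l) Free Deleted"
  "P1 k Deleted Isolated \<Longrightarrow> P2 l Isolated Isolated \<Longrightarrow> P (k + l) Deleted Free"
  "P1 k Deleted Isolated \<Longrightarrow> P2 l Free Deleted \<Longrightarrow> P (k + l) Deleted Deleted"
  "P1 k Deleted Free \<Longrightarrow> P2 l Isolated Deleted \<Longrightarrow> P (k + l) Deleted Deleted"
  "P1 k Dominated Dominated \<Longrightarrow> P2 l Deleted Free \<Longrightarrow> P (k + l) Free Free"
  "P1 k Isolated Dominated \<Longrightarrow> P2 l Deleted Isolated \<Longrightarrow> P (k + l) Free Free"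
  "P1 k Free Deleted \<Longrightarrow> P2 l Dominated Dominated \<Longrightarrow> P (k + l) Free Free"
  "P1 k Isolated Deleted \<Longrightarrow> P2 l Dominated Isolated \<Longrightarrow> P (k + l) Free Free"
  "P1 k Isolated Isolated \<Longrightarrow> P2 l Isolated Dominated \<Longrightarrow> P (k + l) Free Free"
  by (erule (1) attains_glue; simp add: joinable_def covers_def)+

lemma attains_Suc: "P k a b \<Longrightarrow> P (Suc k) a b"
  by (erule attains_weaker) (auto simp: weaker_def)

text \<open>The successor in \<open>m\<close> is the apex, which has degree above 2 when both parts
  have further vertices. The second alternative spends 6 of the joint slack on one more vertex. All
  81 pairs of profiles are checked.\<close>

lemma fits_glue:
  assumes "fits P1 m1 k" "fits P2 m2 l"
  shows "fits P (Suc (m1 + m2)) (k + l) \<or> fits P (Suc (m1 + m2)) (Suc (k + l))"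
  by (cases rule: fits_cases[OF assms(1) refl]; cases rule: fits_cases[OF assms(2) refl];
    (simp add: fits_def[of P] glue_rules attains_Suc; fail))

lemma fits_edge_glue:
  assumes "fits_edge P1" "fits P2 m l"
  shows "fits P (Suc m) l \<or> fits P (Suc m) (Suc l)"
  by (cases rule: fits_edge_cases[OF assms(1) refl]; cases rule: fits_cases[OF assms(2) refl];
    (simp add: fits_def[of P] glue_rules[of 0 l, simplified] attains_Suc; fail))

lemma fits_glue_edge:
  assumes "fits P1 m k" "fits_edge P2"
  shows "fits P (Suc m) k \<or> fits P (Suc m) (Suc k)"
  by (cases rule: fits_cases[OF assms(1) refl]; cases rule: fits_edge_cases[OF assms(2) refl];
    (simp add: fits_def[of P] glue_rules[of k 0, simplified] attains_Suc; fail))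

text \<open>The glued graph is a triangle, whose apex counts twice, as a non-root and as a vertex of
  degree 2.\<close>

lemma fits_edge_edge:
  assumes "fits_edge P1" "fits_edge P2"
  shows "fits P 2 0"
  by (cases rule: fits_edge_cases[OF assms(1) refl]; cases rule: fits_edge_cases[OF assms(2) refl];
    (simp add: fits_def[of P] glue_rules[of 0 0, simplified]; fail))

text \<open>The summand 3 stands for \<open>u\<close>, \<open>v\<close> and \<open>w\<close>, none
  of degree 2 when both parts have further vertices. The profile of the glued graph itself would not
  suffice: with slack 3 it may offer only deleted roots unless a root is chosen, and a chosen root
  costs \<open>6 * k + 6\<close>, one more than the \<open>m + 2\<close> available. Hence the last
  gluing is evaluated directly from the two parts.\<close>

lemma finishes_glue:
  assumes "fits P1 m1 k" "fits P2 m2 l"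
  shows "finishes P (m1 + m2 + 3) (k + l) \<or> finishes P (m1 + m2 + 3) (Suc (k + l))"
  by (cases rule: fits_cases[OF assms(1) refl]; cases rule: fits_cases[OF assms(2) refl];
    (simp add: finishes_def glue_rules attains_Suc; fail))

text \<open>If the first part is just the edge \<open>{u, w}\<close>, then \<open>u\<close> has
  degree 2 in the whole graph and counts twice, which turns 3 into 4.\<close>

lemma finishes_edge_glue:
  assumes "fits_edge P1" "fits P2 m l"
  shows "finishes P (m + 4) l \<or> finishes P (m + 4) (Suc l)"
  by (cases rule: fits_edge_cases[OF assms(1) refl]; cases rule: fits_cases[OF assms(2) refl];
    (simp add: finishes_def glue_rules[of 0 l, simplified] attains_Suc; fail))

end

lemma rooted_mop_edge_iff:
  "rooted_mop u v {u, v} E L \<Longrightarrow> E = {{u, v}} \<and> L = {}"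
proof (erule rooted_mop.cases)
  fix u' v' w V1 E1 L1 V2 E2 L2
  assume *: "u = u'" "v = v'" "{u, v} = V1 \<union> V2" "rooted_mop u' w V1 E1 L1" "rooted_mop w v' V2 E2 L2" "V1 \<inter> V2 = {w}"
  have "w \<noteq> u" "w \<noteq> v" "w \<in> V1" using rooted_mop_basic[OF *(4)] rooted_mop_basic[OF *(5)] * by auto
  then show ?thesis using * by auto
qed auto

lemma rooted_mop_fits:
  assumes "rooted_mop u v W F L"
  shows "if W = {u, v} then fits_edge (attains W F u v)
    else \<exists>k. fits (attains W F u v) (card (W - {u, v}) + card L) k"
  using assms
proof (induction rule: rooted_mop.induct)
  case (edge u v)
  then show ?case using edge_fits by simp
next
  case (glue u w V1 E1 L1 v V2 E2 L2)
  interpret gluing u v w V1 V2 E1 E2 L1 L2 by unfold_locales (use glue in auto)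
  let ?L = "if V1 = {u, w} \<and> V2 = {w, v} then {w} else L1 \<union> L2"
  have ne: "V1 \<union> V2 \<noteq> {u, v}" using vertices by auto
  note c = card_interior and cL = card_L
  have "\<exists>k. fits P (card (V - {u, v}) + card ?L) k"
  proof (cases "V1 = {u, w}")
    case e1: True
    then have f1: "fits_edge P1" "L1 = {}" "card (V1 - {u, w}) = 0"
      using glue.IH(1) rooted_mop_edge_iff[of u w] mop1 by auto
    show ?thesis
    proof (cases "V2 = {w, v}")
      case True
      then have "fits_edge P2" using glue.IH(2) by auto
      from fits_edge_edge[OF f1(1) this] show ?thesis
        using e1 True c f1 by (intro exI[of _ 0]) (simp add: numeral_2_eq_2)
    next
      case False
      then obtain l where "fits P2 (card (V2 - {w, v}) + card L2) l" using glue.IH(2) by auto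
      from fits_edge_glue[OF f1(1) this] show ?thesis using False f1 c by auto
    qed
  next
    case n1: False
    then obtain k where f1: "fits P1 (card (V1 - {u, w}) + card L1) k" using glue.IH(1) by auto
    show ?thesis
    proof (cases "V2 = {w, v}")
      case True
      then have "fits_edge P2" "L2 = {}" "card (V2 - {w, v}) = 0"
        using glue.IH(2) rooted_mop_edge_iff[of w v] mop2 by auto
      with fits_glue_edge[OF f1 this(1)] show ?thesis using n1 c by auto
    next
      case False
      then obtain l where "fits P2 (card (V2 - {w, v}) + card L2) l" using glue.IH(2) by auto
      from fits_glue[OF f1 this] show ?thesis using n1 c cL by (auto simp: ac_simps)
    qed
  qed
  then show ?case using ne unfolding V_def E_def by simp
qed

section \<open>Degrees and colourings\<close>

text \<open>The degree of an apex is the sum of its degrees as a root of the two parts, so it is 2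
  exactly if both parts are edges; the lower bounds at the roots feed this sum.\<close>

lemma rooted_mop_degrees:
  assumes "rooted_mop u v W F L"
  shows "(\<forall>x\<in>W - {u, v}. 2 \<le> vertex_degree F x \<and> (vertex_degree F x = 2 \<longleftrightarrow> x \<in> L)) \<and>
    1 \<le> vertex_degree F u \<and> 1 \<le> vertex_degree F v \<and>
    (W \<noteq> {u, v} \<longrightarrow> 2 \<le> vertex_degree F u \<and> 2 \<le> vertex_degree F v)"
  using assms
proof (induction rule: rooted_mop.induct)
  case (edge u v)
  have "{e \<in> {{u, v}}. u \<in> e} = {{u, v}}" "{e \<in> {{u, v}}. v \<in> e} = {{u, v}}" by auto
  then show ?case by (simp add: vertex_degree_def)
next
  case (glue u w V1 E1 L1 v V2 E2 L2)
  interpret gluing u v w V1 V2 E1 E2 L1 L2 by unfold_locales (use glue in auto)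
  let ?L = "if V1 = {u, w} \<and> V2 = {w, v} then {w} else L1 \<union> L2"
  have d1: "vertex_degree E1 w = 1" if "V1 = {u, w}"
  proof -
    have "E1 = {{u, w}}" using rooted_mop_edge_iff[of u w E1 L1] mop1 that by simp
    then have "{e \<in> E1. w \<in> e} = {{u, w}}" by auto
    then show ?thesis by (simp add: vertex_degree_def)
  qed
  have d2: "vertex_degree E2 w = 1" if "V2 = {w, v}"
  proof -
    have "E2 = {{w, v}}" using rooted_mop_edge_iff[of w v E2 L2] mop2 that by simp
    then have "{e \<in> E2. w \<in> e} = {{w, v}}" by auto
    then show ?thesis by (simp add: vertex_degree_def)
  qed
  have wL: "w \<notin> L1 \<union> L2" using L_sub by blast
  have deg: "2 \<le> vertex_degree E x \<and> (vertex_degree E x = 2 \<longleftrightarrow> x \<in> ?L)" if x: "x \<in> V - {u, v}" for x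
  proof -
    consider "x = w" | "x \<in> V1 - {u, w}" | "x \<in> V2 - {w, v}" using V_cases[of x] x by blast
    then show ?thesis
    proof cases
      case 1
      show ?thesis
      proof (cases "V1 = {u, w} \<and> V2 = {w, v}")
        case True then show ?thesis using 1 d1 d2 degree_apex by simp
      next
        case False
        have "1 \<le> vertex_degree E1 w" "1 \<le> vertex_degree E2 w"
          "V1 \<noteq> {u, w} \<longrightarrow> 2 \<le> vertex_degree E1 w" "V2 \<noteq> {w, v} \<longrightarrow> 2 \<le> vertex_degree E2 w"
          using glue.IH by blast+
        then have "3 \<le> vertex_degree E w" using False degree_apex by auto
        then show ?thesis using 1 False wL by auto
      qed
    next
      case 2
      then have "V1 \<noteq> {u, w}" "x \<notin> L2" using L_sub interior_disjoint(1) by blast+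
      then have "x \<in> ?L \<longleftrightarrow> x \<in> L1" by auto
      then show ?thesis using glue.IH(1) 2 degree_interior1[OF 2] by auto
    next
      case 3
      then have "V2 \<noteq> {w, v}" "x \<notin> L1" using L_sub interior_disjoint(2) by blast+
      then have "x \<in> ?L \<longleftrightarrow> x \<in> L2" by auto
      then show ?thesis using glue.IH(2) 3 degree_interior2[OF 3] by auto
    qed
  qed
  have "2 \<le> vertex_degree E u" "2 \<le> vertex_degree E v" using glue.IH degree_root by auto
  then show ?case using deg unfolding V_def E_def by auto
qed

definition dominating_colours :: "'a set \<Rightarrow> 'a set set \<Rightarrow> 'a set \<Rightarrow> ('a \<Rightarrow> nat) \<Rightarrow> bool" where
  "dominating_colours W F L f \<longleftrightarrow> (\<forall>x\<in>W - L. \<forall>c<3. \<exists>y\<in>W - L. f y = c \<and> (y = x \<or> {x, y} \<in> F))"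

text \<open>Prescribing the colours of both roots makes the two colourings agree at the apex. Two
  non-roots are demanded for domination because with at most one, deleting \<open>L\<close> leaves
  just the edge \<open>{u, v}\<close>, where the third colour is missing.\<close>

lemma rooted_mop_colouring:
  assumes "rooted_mop u v W F L"
  shows "(\<forall>i<3. \<forall>j<3. i \<noteq> j \<longrightarrow> (\<exists>f. f u = i \<and> f v = j \<and> (\<forall>x\<in>W. f x < (3::nat)) \<and>
      (2 \<le> card (W - {u, v}) \<longrightarrow> dominating_colours W F L f))) \<and>
    (\<forall>x\<in>L. \<forall>y\<in>L. {x, y} \<notin> F) \<and> (card (W - {u, v}) < 2 \<longrightarrow> W - {u, v} \<subseteq> L)"
  using assms
proof (induction rule: rooted_mop.induct)
  case (edge u v)
  have "\<exists>f. f u = i \<and> f v = j \<and> (\<forall>x\<in>{u, v}. f x < (3::nat))" if "i < 3" "j < 3" "i \<noteq> j" for i j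
    using that edge by (intro exI[of _ "\<lambda>x. if x = u then i else j"]) auto
  then show ?case by auto
next
  case (glue u w V1 E1 L1 v V2 E2 L2)
  interpret gluing u v w V1 V2 E1 E2 L1 L2 by unfold_locales (use glue in auto)
  let ?L = "if V1 = {u, w} \<and> V2 = {w, v} then {w} else L1 \<union> L2"
  have uw: "{u, w} \<in> E1" and wv: "{w, v} \<in> E2"
    using rooted_mop_basic[OF mop1] rooted_mop_basic[OF mop2] by auto
  have small: "V - {u, v} \<subseteq> ?L" if "card (V - {u, v}) < 2"
  proof -
    have "card (V1 - {u, w}) = 0" "card (V2 - {w, v}) = 0" using that card_interior by auto
    then have "V1 - {u, w} = {}" "V2 - {w, v} = {}" using vertices(10,11) by auto
    then have "V1 = {u, w}" "V2 = {w, v}" using vertices(4-7) by blast+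
    then show ?thesis unfolding V_def by auto
  qed
  have indep: "{x, y} \<notin> E" if "x \<in> ?L" "y \<in> ?L" for x y
  proof
    assume e: "{x, y} \<in> E"
    show False
    proof (cases "V1 = {u, w} \<and> V2 = {w, v}")
      case True
      then have "x = w" "y = w" using that by auto
      then show False using e E1_sub[of w w] E2_sub[of w w] vertices(1-3) unfolding E_def by auto
    next
      case False
      then have "?L = L1 \<union> L2" by (rule if_not_P)
      then have xy: "x \<in> L1 \<union> L2" "y \<in> L1 \<union> L2" using that by (simp_all only:)
      then have "x \<notin> {u, v}" using L_sub vertices(8,9) by blast
      then have "{x, y} \<noteq> {u, v}" by blast
      then have "{x, y} \<in> E1 \<or> {x, y} \<in> E2" using e unfolding E_def by blast
      then show False
      proof
        assume *: "{x, y} \<in> E1"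
        then have "x \<in> L1" "y \<in> L1" using E1_sub[OF *] xy L_sub(2) interior_disjoint(2) by blast+
        then show False using glue.IH(1) * by blast
      next
        assume *: "{x, y} \<in> E2"
        then have "x \<in> L2" "y \<in> L2" using E2_sub[OF *] xy L_sub(1) interior_disjoint(1) by blast+
        then show False using glue.IH(2) * by blast
      qed
    qed
  qed
  have col: "\<exists>f. f u = i \<and> f v = j \<and> (\<forall>x\<in>V. f x < (3::nat)) \<and>
      (2 \<le> card (V - {u, v}) \<longrightarrow> dominating_colours V E ?L f)" if ij: "i < 3" "j < 3" "i \<noteq> j" for i j :: nat
  proof -
    \<comment> \<open>The colours 0, 1, 2 add up to 3, so this is the third one; it goes to the
      apex.\<close>
    define k where "k = 3 - i - j"
    have three: "c = 0 \<or> c = 1 \<or> c = 2" if "c < 3" for c :: nat using that by linarith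
    have k: "k < 3" "k \<noteq> i" "k \<noteq> j"
      using three[OF ij(1)] three[OF ij(2)] ij(3) unfolding k_def by auto
    have all: "c = i \<or> c = j \<or> c = k" if "c < 3" for c
      using three[OF that] three[OF ij(1)] three[OF ij(2)] ij(3) unfolding k_def by auto
    obtain f1 where f1: "f1 u = i" "f1 w = k" "\<forall>x\<in>V1. f1 x < 3"
      "2 \<le> card (V1 - {u, w}) \<longrightarrow> dominating_colours V1 E1 L1 f1"
      using glue.IH(1) ij(1) k(1,2) by blast
    obtain f2 where f2: "f2 w = k" "f2 v = j" "\<forall>x\<in>V2. f2 x < 3"
      "2 \<le> card (V2 - {w, v}) \<longrightarrow> dominating_colours V2 E2 L2 f2"
      using glue.IH(2) ij(2) k(1,3) by blast
    define f where "f x = (if x \<in> V1 then f1 x else f2 x)" for x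
    have fV1: "f x = f1 x" if "x \<in> V1" for x using that by (simp add: f_def)
    have fV2: "f x = f2 x" if "x \<in> V2" for x
    proof (cases "x = w")
      case True then show ?thesis using f1 f2 vertices(5) by (simp add: f_def)
    next
      case False
      then have "x \<notin> V1" using that meet by blast
      then show ?thesis by (simp add: f_def)
    qed
    have fu: "f u = i" "f v = j" "f w = k" using fV1 fV2 f1 f2 vertices(4-7) by auto
    have "dominating_colours V E ?L f" if big: "2 \<le> card (V - {u, v})"
      unfolding dominating_colours_def
    proof (intro ballI allI impI)
      fix x c assume x: "x \<in> V - ?L" and c: "c < (3::nat)"
      \<comment> \<open>Two non-roots keep the apex out of \<open>?L\<close>, so the triangle
        \<open>u\<close>, \<open>w\<close>, \<open>v\<close> survives and shows each of its vertices
        all three colours.\<close>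
      have "\<not> (V1 = {u, w} \<and> V2 = {w, v})" using big card_interior by auto
      then have L: "?L = L1 \<union> L2" by auto
      have nl: "u \<in> V - ?L" "v \<in> V - ?L" "w \<in> V - ?L"
        using L L_sub vertices(4-9) unfolding V_def by blast+
      have tri: "{u, w} \<in> E" "{w, v} \<in> E" "{u, v} \<in> E" using uw wv unfolding E_def by auto
      have root: "\<exists>y\<in>V - ?L. f y = c \<and> (y = x \<or> {x, y} \<in> E)" if "x \<in> {u, v, w}"
      proof -
        obtain y where y: "y \<in> {u, v, w}" "f y = c" using all[OF c] fu by blast
        have "y = x \<or> {x, y} \<in> E" using that y(1) tri by (auto simp: insert_commute)
        moreover have "y \<in> V - ?L" using y(1) nl by blast
        ultimately show ?thesis using y(2) by blast
      qed
      consider "x \<in> {u, v, w}" | "x \<in> V1 - {u, w}" | "x \<in> V2 - {w, v}" using V_cases[of x] x by blast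
      then show "\<exists>y\<in>V - ?L. f y = c \<and> (y = x \<or> {x, y} \<in> E)"
      proof cases
        case 1 then show ?thesis by (rule root)
      next
        case 2
        then have "x \<in> V1 - L1" using x L by blast
        \<comment> \<open>A part with fewer than two non-roots has all of them in \<open>L1\<close>,
          and \<open>x\<close> is not there; so the colouring of this part is dominating.\<close>
        moreover from this have "2 \<le> card (V1 - {u, w})" using glue.IH(1) 2 by (meson DiffE not_le subsetD)
        ultimately obtain y where y: "y \<in> V1 - L1" "f1 y = c" "y = x \<or> {x, y} \<in> E1"
          using f1(4) c unfolding dominating_colours_def by blast
        have "y \<notin> L2" using y(1) L_sub(2) interior_disjoint(2) by blast
        then have "y \<in> V - ?L" using y(1) L unfolding V_def by blast
        then show ?thesis using y fV1 unfolding E_def by blast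
      next
        case 3
        then have "x \<in> V2 - L2" using x L by blast
        moreover from this have "2 \<le> card (V2 - {w, v})" using glue.IH(2) 3 by (meson DiffE not_le subsetD)
        ultimately obtain y where y: "y \<in> V2 - L2" "f2 y = c" "y = x \<or> {x, y} \<in> E2"
          using f2(4) c unfolding dominating_colours_def by blast
        have "y \<notin> L1" using y(1) L_sub(1) interior_disjoint(1) by blast
        then have "y \<in> V - ?L" using y(1) L unfolding V_def by blast
        then show ?thesis using y fV2 unfolding E_def by blast
      qed
    qed
    then show ?thesis using fu fV1 fV2 f1(3) f2(3) unfolding V_def by (intro exI[of _ f]) auto
  qed
  show ?case using small indep col unfolding V_def E_def by blast
qed

section \<open>From partial solutions and colour classes to the two bounds\<close>

lemma iota1_le: "K12_isolating V E S \<Longrightarrow> iota1 V E \<le> card S"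
  unfolding iota1_def by (rule Least_le) blast

lemma K12_isolatingI:
  assumes "S \<subseteq> V" "K12_free E (V - closed_nbhd E S)"
  shows "K12_isolating V E S"
  using assms unfolding K12_isolating_def contains_K12_def induced_edges_def K12_free_def by blast

text \<open>With no root deleted, a partial solution isolates the whole graph; its chosen roots,
  missing from the count \<open>k\<close>, are added back.\<close>

lemma finishes_iota1:
  assumes "finishes (attains V E u v) m k" "finite V"
  shows "6 * iota1 V E \<le> m"
proof -
  have *: "iota1 V E \<le> k + (if a = Chosen then 1 else 0) + (if b = Chosen then 1 else 0)"
    if att: "attains V E u v k a b" and ab: "a \<noteq> Deleted" "b \<noteq> Deleted" for a b
  proof -
    obtain X where X: "partial_iso V E u v a b X" "card (X - {u, v}) \<le> k"
      using att by (auto simp: attains_def)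
    have XV: "X \<subseteq> V" "K12_free E (V - closed_nbhd E X)"
      using X ab by (auto simp: partial_iso_def residual_def)
    have uv: "u \<in> X \<longrightarrow> a = Chosen" "v \<in> X \<longrightarrow> b = Chosen"
      using X(1) by (cases a; cases b; simp add: partial_iso_def)+
    have fin: "finite X" using XV assms(2) finite_subset by blast
    have "X \<subseteq> (X - {u, v}) \<union> (if a = Chosen then {u} else {}) \<union> (if b = Chosen then {v} else {})"
      using uv by auto
    then have "card X \<le> card ((X - {u, v}) \<union> (if a = Chosen then {u} else {}) \<union> (if b = Chosen then {v} else {}))"
      using fin by (intro card_mono) auto
    also have "\<dots> \<le> card (X - {u, v}) + card (if a = Chosen then {u} else {}) + card (if b = Chosen then {v} else {})"
      by (intro order_trans[OF card_Un_le] add_mono card_Un_le) auto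
    also have "\<dots> \<le> k + (if a = Chosen then 1 else 0) + (if b = Chosen then 1 else 0)"
      using X(2) by auto
    finally show ?thesis using iota1_le[OF K12_isolatingI[OF XV]] by simp
  qed
  show ?thesis
    using assms(1) *[of Free Free] *[of Chosen Dominated] *[of Dominated Chosen] *[of Chosen Chosen]
    unfolding finishes_def by auto
qed

lemma pigeonhole_colours:
  assumes "finite A" "\<forall>x\<in>A. f x < (3::nat)"
  shows "\<exists>c<3. 3 * card {x \<in> A. f x = c} \<le> card A"
proof -
  have "A = {x \<in> A. f x = 0} \<union> {x \<in> A. f x = 1} \<union> {x \<in> A. f x = 2}"
    using assms(2) by (auto simp: numeral_3_eq_3 less_Suc_eq)
  then have "card A = card ({x \<in> A. f x = 0} \<union> {x \<in> A. f x = 1} \<union> {x \<in> A. f x = 2})" by simp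
  also have "\<dots> = card {x \<in> A. f x = 0} + card {x \<in> A. f x = 1} + card {x \<in> A. f x = 2}"
  proof -
    have "({x \<in> A. f x = 0} \<union> {x \<in> A. f x = 1}) \<inter> {x \<in> A. f x = 2} = {}"
      "{x \<in> A. f x = 0} \<inter> {x \<in> A. f x = 1} = {}" by auto
    then show ?thesis using assms(1) by (simp add: card_Un_disjoint)
  qed
  finally have "3 * card {x \<in> A. f x = 0} \<le> card A \<or> 3 * card {x \<in> A. f x = 1} \<le> card A \<or>
    3 * card {x \<in> A. f x = 2} \<le> card A" by linarith
  then show ?thesis
  proof (elim disjE)
    assume "3 * card {x \<in> A. f x = 0} \<le> card A"
    then show ?thesis by (intro exI[of _ 0]) simp
  next
    assume "3 * card {x \<in> A. f x = 1} \<le> card A"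
    then show ?thesis by (intro exI[of _ 1]) simp
  next
    assume "3 * card {x \<in> A. f x = 2} \<le> card A"
    then show ?thesis by (intro exI[of _ 2]) simp
  qed
qed

text \<open>The coloured graph may be a proper subgraph because a root of the full graph can have
  degree 2 and must then be deleted too, although \<open>L\<close> contains no roots. What a small
  colour class leaves undominated lies in an independent set.\<close>

lemma rooted_mop_coloured_iota1:
  assumes mop: "rooted_mop u v W F L" and big: "2 \<le> card (W - {u, v})"
    and W: "W \<subseteq> V" and F: "F \<subseteq> E" and indep: "\<And>x y. x \<in> V - (W - L) \<Longrightarrow> y \<in> V - (W - L) \<Longrightarrow> {x, y} \<notin> E"
  shows "3 * iota1 V E \<le> card (W - L)"
proof -
  obtain f where f: "\<forall>x\<in>W. f x < (3::nat)" "dominating_colours W F L f"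
    using conjunct1[OF rooted_mop_colouring[OF mop], rule_format, of 0 1] big by auto
  have fin: "finite (W - L)" using rooted_mop_basic[OF mop] by blast
  obtain c where c: "c < 3" "3 * card {x \<in> W - L. f x = c} \<le> card (W - L)"
    using pigeonhole_colours[OF fin, of f] f(1) by blast
  let ?S = "{x \<in> W - L. f x = c}"
  have dom: "x \<in> closed_nbhd E ?S" if x: "x \<in> W - L" for x
  proof -
    obtain y where "y \<in> W - L" "f y = c" "y = x \<or> {x, y} \<in> F"
      using f(2) c(1) x unfolding dominating_colours_def by blast
    moreover from this have "y = x \<or> {y, x} \<in> E" using F by (auto simp: insert_commute)
    ultimately show ?thesis unfolding closed_nbhd_def by blast
  qed
  have "K12_isolating V E ?S"
  proof (rule K12_isolatingI)
    show "?S \<subseteq> V" using W by blast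
    have "V - closed_nbhd E ?S \<subseteq> V - (W - L)" using dom by blast
    then show "K12_free E (V - closed_nbhd E ?S)" unfolding K12_free_def using indep by blast
  qed
  then show ?thesis using iota1_le c(2) by fastforce
qed

text \<open>Here the root \<open>u\<close> has degree 2: it adds one to \<open>n2\<close> and joins
  the deleted vertices. The colouring is therefore taken on the second part, rooted at
  \<open>w\<close> and \<open>v\<close>.\<close>

lemma rooted_mop_iota1_edge:
  assumes "gluing u v w V1 V2 E1 E2 L1 L2" and V1: "V1 = {u, w}"
    and V: "V = V1 \<union> V2" and E: "E = insert {u, v} (E1 \<union> E2)" and n: "5 \<le> card V"
    and n2: "n2 = card {x \<in> V. vertex_degree E x = 2}"
  shows "6 * iota1 V E \<le> card V + n2 \<and> 3 * iota1 V E + n2 \<le> card V"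
proof -
  interpret g: gluing u v w V1 V2 E1 E2 L1 L2 by fact
  have VE: "g.V = V" "g.E = E" unfolding g.V_def g.E_def V E by auto
  have E1: "E1 = {{u, w}}" "L1 = {}" using rooted_mop_edge_iff[of u w E1 L1] g.mop1 V1 by auto
  have f1: "fits_edge g.P1" using rooted_mop_fits[OF g.mop1] V1 by simp
  have V': "V = insert u V2" unfolding V V1 using g.vertices(6) by auto
  then have cV: "card V = Suc (card V2)" using g.vertices(8,11) by simp
  have "V2 = insert w (insert v (V2 - {w, v}))" using g.vertices(6,7) by blast
  then have "card V2 = card (insert w (insert v (V2 - {w, v})))" by simp
  also have "\<dots> = card (V2 - {w, v}) + 2" using g.vertices(3,11) by simp
  finally have c2: "card V2 = card (V2 - {w, v}) + 2" .
  have ne: "V2 \<noteq> {w, v}" using cV n c2 by auto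
  obtain l where "fits g.P2 (card (V2 - {w, v}) + card L2) l"
    using rooted_mop_fits[OF g.mop2] ne by auto
  from g.finishes_edge_glue[OF f1 this] have A: "6 * iota1 V E \<le> card (V2 - {w, v}) + card L2 + 4"
    using finishes_iota1[of V E] g.vertices(10,11) VE V by auto
  have mop: "rooted_mop u v V E L2"
    using rooted_mop.glue[OF g.mop1 g.mop2 g.meet] ne E1(2) unfolding V E by simp
  note deg = rooted_mop_degrees[OF mop] and deg2 = rooted_mop_degrees[OF g.mop2]
  have "vertex_degree E1 u = 1"
  proof -
    have "{e \<in> E1. u \<in> e} = {{u, w}}" using E1 by auto
    then show ?thesis by (simp add: vertex_degree_def)
  qed
  then have du: "vertex_degree E u = 2" using g.degree_root(1) VE by simp
  have dv: "vertex_degree E v \<noteq> 2" using g.degree_root(2) deg2 ne VE by auto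
  have "{x \<in> V. vertex_degree E x = 2} = insert u L2"
  proof (intro equalityI subsetI)
    fix x assume "x \<in> {x \<in> V. vertex_degree E x = 2}"
    then show "x \<in> insert u L2" using deg dv by blast
  next
    fix x assume "x \<in> insert u L2"
    then show "x \<in> {x \<in> V. vertex_degree E x = 2}"
      using deg du rooted_mop_basic[OF mop] by blast
  qed
  moreover have finL: "finite L2" and uL: "u \<notin> L2" "L2 \<subseteq> V2" "w \<notin> L2" "v \<notin> L2"
    using g.L_sub(2) g.vertices(8,11) finite_subset by blast+
  ultimately have n2': "n2 = Suc (card L2)" using n2 by simp
  have B: "3 * iota1 V E \<le> card (V2 - L2)"
  proof (rule rooted_mop_coloured_iota1[OF g.mop2])
    show "2 \<le> card (V2 - {w, v})" using n cV c2 by simp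
    show "V2 \<subseteq> V" "E2 \<subseteq> E" unfolding V E by auto
    fix x y assume "x \<in> V - (V2 - L2)" "y \<in> V - (V2 - L2)"
    then have xy: "x \<in> insert u L2" "y \<in> insert u L2" using V' by blast+
    show "{x, y} \<notin> E"
    proof
      assume e: "{x, y} \<in> E"
      have "{x, y} \<noteq> {u, v}" "{x, y} \<noteq> {u, w}" using xy uL g.vertices(1-3) by auto
      then have e2: "{x, y} \<in> E2" using e E E1 by auto
      then have "x \<in> V2" "y \<in> V2" using g.E2_sub by blast+
      then have "x \<in> L2" "y \<in> L2" using xy g.vertices(8) by blast+
      then show False using rooted_mop_colouring[OF g.mop2] e2 by blast
    qed
  qed
  have "card (V2 - L2) = card V2 - card L2" "card L2 \<le> card V2"
    using card_Diff_subset[OF finL uL(2)] card_mono[OF g.vertices(11) uL(2)] by auto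
  then show ?thesis using A B n2' cV c2 by linarith
qed

theorem rooted_mop_iota1:
  assumes mop: "rooted_mop u v V E L" and n: "5 \<le> card V"
    and n2: "n2 = card {x \<in> V. vertex_degree E x = 2}"
  shows "6 * iota1 V E \<le> card V + n2 \<and> 3 * iota1 V E + n2 \<le> card V"
proof -
  have "V \<noteq> {u, v}"
  proof
    assume "V = {u, v}"
    then have "card V \<le> 2" by (simp add: card_insert_if)
    then show False using n by simp
  qed
  with mop obtain w V1 E1 L1 V2 E2 L2 where
    g: "rooted_mop u w V1 E1 L1" "rooted_mop w v V2 E2 L2" "V1 \<inter> V2 = {w}"
    and V: "V = V1 \<union> V2" and E: "E = insert {u, v} (E1 \<union> E2)"
    and L: "L = (if V1 = {u, w} \<and> V2 = {w, v} then {w} else L1 \<union> L2)"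
    by (cases rule: rooted_mop.cases) auto
  interpret g: gluing u v w V1 V2 E1 E2 L1 L2 by unfold_locales (use g in auto)
  have VE: "g.V = V" "g.E = E" unfolding g.V_def g.E_def V E by auto
  consider "V1 = {u, w}" | "V2 = {w, v}" | "V1 \<noteq> {u, w}" "V2 \<noteq> {w, v}" by blast
  then show ?thesis
  proof cases
    case 1
    then show ?thesis using rooted_mop_iota1_edge[OF g.gluing_axioms _ V E n n2] by blast
  next
    case 2
    have "gluing v u w V2 V1 E2 E1 L2 L1"
      by unfold_locales (use g rooted_mop_sym in auto)
    then show ?thesis using rooted_mop_iota1_edge[of v u w V2 V1 E2 E1 L2 L1 V E n2] 2 V E n n2
      by (simp add: insert_commute Un_commute)
  next
    case 3
    obtain k where k: "fits g.P1 (card (V1 - {u, w}) + card L1) k"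
      using rooted_mop_fits[OF g(1)] 3 by auto
    obtain l where l: "fits g.P2 (card (V2 - {w, v}) + card L2) l"
      using rooted_mop_fits[OF g(2)] 3 by auto
    have A: "6 * iota1 V E \<le> (card (V1 - {u, w}) + card L1) + (card (V2 - {w, v}) + card L2) + 3"
      using g.finishes_glue[OF k l] finishes_iota1[of V E] g.vertices(10,11) VE V by auto
    have L': "L = L1 \<union> L2" using L 3 by simp
    have "V = insert u (insert v (V - {u, v}))" using g.vertices(4,7) V by blast
    then have "card V = card (insert u (insert v (V - {u, v})))" by simp
    also have "\<dots> = card (V - {u, v}) + 2" using g.vertices(1,10,11) V by simp
    finally have cV: "card V = card (V1 - {u, w}) + card (V2 - {w, v}) + 3"
      using g.card_interior VE by simp
    note deg = rooted_mop_degrees[OF mop]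
    \<comment> \<open>Each root has degree at least 2 in its own part and gains the root edge, so
      \<open>L\<close> misses no vertex of degree 2.\<close>
    have "vertex_degree E u \<noteq> 2" "vertex_degree E v \<noteq> 2"
      using g.degree_root rooted_mop_degrees[OF g(1)] rooted_mop_degrees[OF g(2)] 3 VE by auto
    then have "{x \<in> V. vertex_degree E x = 2} = L"
      using deg rooted_mop_basic[OF mop] by blast
    then have n2': "n2 = card L1 + card L2" using n2 g.card_L L' by simp
    have LV: "L \<subseteq> V" "finite V" using rooted_mop_basic[OF mop] by auto
    have "card (V1 - {u, w}) \<noteq> 0" using 3 g.vertices(4,5,10) by auto
    then have "2 \<le> card (V - {u, v})" using g.card_interior VE by simp
    then have B: "3 * iota1 V E \<le> card (V - L)"
      by (rule rooted_mop_coloured_iota1[OF mop]) (use rooted_mop_colouring[OF mop] in auto)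
    have "card (V - L) = card V - card L" "card L \<le> card V"
      using card_Diff_subset[of L V] card_mono[of V L] LV finite_subset by auto
    then show ?thesis using A B n2' cV g.card_L L' by simp
  qed
qed

section \<open>Theta curves\<close>

text \<open>Arcs as point sets with two ends: orientation and parametrisation drop out, which
  matters when one arc takes part in several closed curves.\<close>

definition joined_by :: "complex set \<Rightarrow> complex \<Rightarrow> complex \<Rightarrow> bool" where
  "joined_by S a b \<longleftrightarrow> (\<exists>g. arc g \<and> pathstart g = a \<and> pathfinish g = b \<and> path_image g = S)"

lemma joined_by_sym: "joined_by S a b \<Longrightarrow> joined_by S b a"
  unfolding joined_by_def by (metis arc_reversepath path_image_reversepath pathfinish_reversepath pathstart_reversepath)

lemma joined_by_facts:
  assumes "joined_by S a b"
  shows "a \<noteq> b" "a \<in> S" "b \<in> S" "compact S" "connected S" "connected (S - {a, b})" "S - {a, b} \<noteq> {}"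
    "inside S = {}"
proof -
  obtain g where g: "arc g" "pathstart g = a" "pathfinish g = b" "path_image g = S"
    using assms by (auto simp: joined_by_def)
  show "a \<noteq> b" using g arc_distinct_ends by blast
  show "a \<in> S" "b \<in> S" using g by auto
  show "compact S" "connected S" using g compact_arc_image connected_arc_image by blast+
  show "connected (S - {a, b})" "S - {a, b} \<noteq> {}"
    using g connected_simple_path_endless nonempty_simple_path_endless arc_imp_simple_path by blast+
  show "inside S = {}" using g inside_arc_empty by blast
qed

lemma Jordan_joined_by:
  assumes "joined_by S a b" "joined_by T a b" "S \<inter> T = {a, b}"
  shows "inside (S \<union> T) \<noteq> {}" "open (inside (S \<union> T))" "connected (inside (S \<union> T))"
    "connected (outside (S \<union> T))" "bounded (inside (S \<union> T))" "open (outside (S \<union> T))"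
    "frontier (inside (S \<union> T)) = S \<union> T"
proof -
  obtain g h where g: "arc g" "pathstart g = a" "pathfinish g = b" "path_image g = S"
    and h: "arc h" "pathstart h = b" "pathfinish h = a" "path_image h = T"
    using assms(1) joined_by_sym[OF assms(2)] by (auto simp: joined_by_def)
  have "simple_path (g +++ h)" using g h assms(3) by (intro simple_path_join_loop) auto
  moreover have "pathfinish (g +++ h) = pathstart (g +++ h)" using g h by simp
  moreover have "path_image (g +++ h) = S \<union> T" using g h by (simp add: path_image_join)
  ultimately show "inside (S \<union> T) \<noteq> {}" "open (inside (S \<union> T))" "connected (inside (S \<union> T))"
    "connected (outside (S \<union> T))" "bounded (inside (S \<union> T))" "open (outside (S \<union> T))"
    "frontier (inside (S \<union> T)) = S \<union> T"
    using Jordan_inside_outside[of "g +++ h"] by auto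
qed

lemma closure_inside_joined_by:
  assumes "joined_by S a b" "joined_by T a b" "S \<inter> T = {a, b}"
  shows "closure (inside (S \<union> T)) = inside (S \<union> T) \<union> S \<union> T"
  using Jordan_joined_by(2,7)[OF assms] closure_Un_frontier[of "inside (S \<union> T)"] by auto

lemma connected_subset_inside:
  assumes "connected T" "T \<inter> C = {}" "T \<inter> inside C \<noteq> {}"
  shows "T \<subseteq> inside C"
proof
  fix y assume y: "y \<in> T"
  obtain x where x: "x \<in> T" "x \<in> inside C" using assms(3) by blast
  have "connected_component (- C) x y"
    unfolding connected_component_def using assms x y by blast
  then show "y \<in> inside C" using inside_same_component x by blast
qed

lemma theta_split:
  assumes A: "joined_by A a b" and B: "joined_by B a b" and C: "joined_by C a b"
    and AB: "A \<inter> B = {a, b}" and AC: "A \<inter> C = {a, b}" and BC: "B \<inter> C = {a, b}"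
    and C_in: "C \<inter> inside (A \<union> B) \<noteq> {}"
  shows "inside (A \<union> B) = inside (A \<union> C) \<union> inside (B \<union> C) \<union> (C - {a, b})"
proof -
  obtain f g h where f: "arc f" "pathstart f = a" "pathfinish f = b" "path_image f = A"
    and g: "arc g" "pathstart g = a" "pathfinish g = b" "path_image g = B"
    and h: "arc h" "pathstart h = a" "pathfinish h = b" "path_image h = C"
    using A B C unfolding joined_by_def by metis
  show ?thesis
    using split_inside_simple_closed_curve[of f a b g h] f g h AB AC BC C_in
      joined_by_facts(1)[OF A] arc_imp_simple_path by metis
qed

text \<open>A point inside \<open>A \<union> B\<close> that is outside both \<open>A \<union> C\<close> and \<open>B \<union> C\<close> would, by Janiszewski's
  theorem for these two sets with connected intersection \<open>C\<close>, be outside \<open>A \<union> B \<union> C\<close>.\<close>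
lemma theta_outer_arc:
  assumes A: "joined_by A a b" and B: "joined_by B a b" and C: "joined_by C a b"
    and AB: "A \<inter> B = {a, b}" and AC: "A \<inter> C = {a, b}" and BC: "B \<inter> C = {a, b}"
    and C_out: "C \<inter> inside (A \<union> B) = {}"
  shows "A - {a, b} \<subseteq> inside (B \<union> C) \<or> B - {a, b} \<subseteq> inside (A \<union> C)"
proof -
  note JAB = Jordan_joined_by[OF A B AB] and JAC = Jordan_joined_by[OF A C AC]
    and JBC = Jordan_joined_by[OF B C BC]
  have comp: "compact A" "compact B" "compact C" "connected C" and ab: "a \<in> C" "b \<in> C"
    using joined_by_facts[OF A] joined_by_facts[OF B] joined_by_facts[OF C] by auto
  obtain p where p: "p \<in> inside (A \<union> B)" using JAB(1) by blast
  have pn: "p \<notin> A \<union> B \<union> C" using p C_out inside_no_overlap[of "A \<union> B"] by blast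
  have "outside (A \<union> B \<union> C) \<noteq> {}"
    using comp by (metis compact_Un compact_imp_bounded outside_bounded_nonempty)
  then obtain z where z: "z \<in> outside (A \<union> B \<union> C)" by blast
  have zo: "z \<in> outside (A \<union> B)" "z \<in> outside (A \<union> C)" "z \<in> outside (B \<union> C)"
    using z outside_mono[of "A \<union> B" "A \<union> B \<union> C"] outside_mono[of "A \<union> C" "A \<union> B \<union> C"]
      outside_mono[of "B \<union> C" "A \<union> B \<union> C"] by blast+
  have *: "p \<in> inside (A \<union> C) \<or> p \<in> inside (B \<union> C)"
  proof (rule ccontr)
    assume "\<not> ?thesis"
    then have "p \<in> outside (A \<union> C)" "p \<in> outside (B \<union> C)"
      using pn inside_Un_outside[of "A \<union> C"] inside_Un_outside[of "B \<union> C"] by blast+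
    then have "connected_component (- (A \<union> C)) p z" "connected_component (- (B \<union> C)) p z"
      using zo JAC(4) JBC(4) outside_no_overlap[of "A \<union> C"] outside_no_overlap[of "B \<union> C"]
      unfolding connected_component_def by (metis disjoint_eq_subset_Compl)+
    note cc = this
    have "(A \<union> C) \<inter> (B \<union> C) = C" using AB ab by auto
    then have con: "connected ((A \<union> C) \<inter> (B \<union> C))" using comp(4) by (simp only:)
    have "connected_component (- ((A \<union> C) \<union> (B \<union> C))) p z"
      by (rule Janiszewski[OF compact_Un[OF comp(1,3)] compact_imp_closed[OF compact_Un[OF comp(2,3)]] con cc])
    then have "connected_component (- (A \<union> B)) p z"
      by (rule connected_component_of_subset) auto
    then have "z \<in> inside (A \<union> B)" using inside_same_component p by blast
    then show False using zo(1) inside_Int_outside by blast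
  qed
  \<comment> \<open>The inside of \<open>A \<union> B\<close> is connected and misses
    \<open>S \<union> C\<close>, so the single point \<open>p\<close> draws all of it into the
    inside of \<open>S \<union> C\<close>. Taking closures draws in \<open>T\<close> as well, which
    lies on its boundary.\<close>
  have sub: "T - {a, b} \<subseteq> inside (S \<union> C)"
    if "p \<in> inside (S \<union> C)" "S \<subseteq> A \<union> B" "T \<subseteq> A \<union> B" "joined_by S a b" "S \<inter> C = {a, b}"
      "T \<inter> C = {a, b}" "S \<inter> T = {a, b}" for S T
  proof -
    have "inside (A \<union> B) \<subseteq> inside (S \<union> C)"
    proof (rule connected_subset_inside[OF JAB(3)])
      show "inside (A \<union> B) \<inter> (S \<union> C) = {}"
        using C_out that(2) inside_no_overlap[of "A \<union> B"] by blast
    qed (use p that in blast)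
    then have "closure (inside (A \<union> B)) \<subseteq> closure (inside (S \<union> C))" by (rule closure_mono)
    then have "A \<union> B \<subseteq> inside (S \<union> C) \<union> S \<union> C"
      using closure_inside_joined_by[OF A B AB] closure_inside_joined_by[OF that(4) C that(5)] by blast
    then have T_sub: "T \<subseteq> inside (S \<union> C) \<union> S \<union> C" using that(3) by (rule order_trans[rotated])
    show ?thesis
    proof
      fix x assume x: "x \<in> T - {a, b}"
      then have "x \<notin> S \<inter> T" "x \<notin> T \<inter> C" unfolding that(6,7) by simp_all
      then show "x \<in> inside (S \<union> C)" using x T_sub by auto
    qed
  qed
  from * show ?thesis
  proof
    assume "p \<in> inside (A \<union> C)"
    from sub[OF this Un_upper1 Un_upper2 A AC BC AB] show ?thesis by (rule disjI2)
  next
    assume "p \<in> inside (B \<union> C)"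
    from sub[OF this Un_upper2 Un_upper1 B BC AC] AB show ?thesis by (simp add: Int_commute)
  qed
qed

section \<open>Cycles in plane graphs\<close>

fun path_edges :: "'a list \<Rightarrow> 'a set set" where
  "path_edges (x # y # xs) = insert {x, y} (path_edges (y # xs))"
| "path_edges _ = {}"

lemma path_edges_append: "path_edges (xs @ x # ys) = path_edges (xs @ [x]) \<union> path_edges (x # ys)"
  by (induction xs rule: path_edges.induct) simp_all

lemma path_edges_snoc: "path_edges (xs @ [x, y]) = insert {x, y} (path_edges (xs @ [x]))"
  using path_edges_append[of xs x "[y]"] by simp

lemma path_edges_rev: "path_edges (rev xs) = path_edges xs"
proof (induction xs rule: path_edges.induct)
  case (1 x y xs)
  then show ?case using path_edges_snoc[of "rev xs" y x] by (simp add: insert_commute)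
qed auto

lemma path_edges_sub: "e \<in> path_edges xs \<Longrightarrow> e \<subseteq> set xs"
  by (induction xs rule: path_edges.induct) auto

lemma path_edges_cover: "2 \<le> length xs \<Longrightarrow> x \<in> set xs \<Longrightarrow> \<exists>e\<in>path_edges xs. x \<in> e"
proof (induction xs rule: path_edges.induct)
  case (1 x' y xs)
  then show ?case by (cases xs) auto
qed auto

section \<open>Drawn paths and cycles\<close>

locale plane_graph =
  fixes V :: "'a set" and E :: "'a set set" and \<phi> :: "'a \<Rightarrow> complex" and \<gamma> :: "'a set \<Rightarrow> real \<Rightarrow> complex"
  assumes simple: "simple_graph V E" and emb: "plane_embedding V E \<phi> \<gamma>"
begin

definition gpath :: "'a list \<Rightarrow> bool" where
  "gpath xs \<longleftrightarrow> distinct xs \<and> path_edges xs \<subseteq> E \<and> 2 \<le> length xs"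

definition im :: "'a set \<Rightarrow> complex set" where "im e = path_image (\<gamma> e)"

definition trace :: "'a list \<Rightarrow> complex set" where "trace xs = \<Union> (im ` path_edges xs)"

lemma edgeD: "e \<in> E \<Longrightarrow> e \<subseteq> V" "e \<in> E \<Longrightarrow> card e = 2" "{x, y} \<in> E \<Longrightarrow> x \<in> V \<and> y \<in> V \<and> x \<noteq> y"
  using simple unfolding simple_graph_def by (auto dest!: bspec)

lemma phi_eq: "x \<in> V \<Longrightarrow> y \<in> V \<Longrightarrow> \<phi> x = \<phi> y \<longleftrightarrow> x = y"
  using emb unfolding plane_embedding_def by (auto dest: inj_onD)

lemma im_Int: "e \<in> E \<Longrightarrow> f \<in> E \<Longrightarrow> e \<noteq> f \<Longrightarrow> im e \<inter> im f = \<phi> ` (e \<inter> f)"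
  using emb unfolding plane_embedding_def im_def by blast

lemma im_vertex: "e \<in> E \<Longrightarrow> x \<in> V \<Longrightarrow> \<phi> x \<in> im e \<longleftrightarrow> x \<in> e"
proof -
  assume *: "e \<in> E" "x \<in> V"
  then have "im e \<inter> \<phi> ` V = \<phi> ` e" using emb unfolding plane_embedding_def im_def by blast
  then show ?thesis using * edgeD(1)[OF *(1)] phi_eq by blast
qed

lemma joined_edge:
  assumes "{x, y} \<in> E" shows "joined_by (im {x, y}) (\<phi> x) (\<phi> y)"
proof -
  let ?g = "\<gamma> {x, y}"
  have *: "arc ?g" "{pathstart ?g, pathfinish ?g} = {\<phi> x, \<phi> y}"
    using assms emb unfolding plane_embedding_def by (auto dest!: bspec)
  then consider "pathstart ?g = \<phi> x" "pathfinish ?g = \<phi> y" | "pathstart ?g = \<phi> y" "pathfinish ?g = \<phi> x"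
    by (auto simp: doubleton_eq_iff)
  then show ?thesis
  proof cases
    case 1 then show ?thesis using * unfolding joined_by_def im_def by blast
  next
    case 2
    then have "joined_by (im {x, y}) (\<phi> y) (\<phi> x)" using * unfolding joined_by_def im_def by blast
    then show ?thesis by (rule joined_by_sym)
  qed
qed

lemma joined_edge': "e \<in> E \<Longrightarrow> \<exists>x y. e = {x, y} \<and> x \<in> V \<and> y \<in> V \<and> joined_by (im e) (\<phi> x) (\<phi> y)"
proof -
  assume e: "e \<in> E"
  then obtain x y where "e = {x, y}" using edgeD(2) card_2_iff by metis
  then show ?thesis using joined_edge edgeD(3) e by blast
qed

lemma gpath_V: "gpath xs \<Longrightarrow> set xs \<subseteq> V"
proof
  fix x assume "gpath xs" "x \<in> set xs"
  then obtain e where "e \<in> E" "x \<in> e" using path_edges_cover[of xs x] by (auto simp: gpath_def)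
  then show "x \<in> V" using edgeD(1)[of e] by blast
qed

lemma gpath_edge: "gpath [x, y] \<longleftrightarrow> {x, y} \<in> E"
  unfolding gpath_def using edgeD(3) by auto

lemma trace_edge: "trace [x, y] = im {x, y}"
  by (simp add: trace_def)

lemma trace_vertex: "gpath xs \<Longrightarrow> x \<in> V \<Longrightarrow> \<phi> x \<in> trace xs \<longleftrightarrow> x \<in> set xs"
proof -
  assume *: "gpath xs" "x \<in> V"
  have "\<phi> x \<in> trace xs \<longleftrightarrow> (\<exists>e\<in>path_edges xs. \<phi> x \<in> im e)" by (auto simp: trace_def)
  also have "\<dots> \<longleftrightarrow> (\<exists>e\<in>path_edges xs. x \<in> e)" using * im_vertex by (auto simp: gpath_def)
  also have "\<dots> \<longleftrightarrow> x \<in> set xs"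
    using path_edges_cover[of xs x] path_edges_sub[of _ xs] * by (auto simp: gpath_def)
  finally show ?thesis .
qed

lemma trace_Int:
  assumes "gpath xs" "gpath ys" "path_edges xs \<inter> path_edges ys = {}"
  shows "trace xs \<inter> trace ys = \<phi> ` (set xs \<inter> set ys)"
proof (intro equalityI subsetI)
  fix p assume "p \<in> trace xs \<inter> trace ys"
  then obtain e f where ef: "e \<in> path_edges xs" "f \<in> path_edges ys" "p \<in> im e" "p \<in> im f"
    unfolding trace_def by blast
  then have "p \<in> \<phi> ` (e \<inter> f)" using im_Int[of e f] assms unfolding gpath_def by blast
  then show "p \<in> \<phi> ` (set xs \<inter> set ys)" using path_edges_sub[OF ef(1)] path_edges_sub[OF ef(2)] by blast
next
  fix p assume "p \<in> \<phi> ` (set xs \<inter> set ys)"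
  then show "p \<in> trace xs \<inter> trace ys"
    using trace_vertex[OF assms(1)] trace_vertex[OF assms(2)] gpath_V[OF assms(1)] by blast
qed

lemma joined_trace: "gpath xs \<Longrightarrow> joined_by (trace xs) (\<phi> (hd xs)) (\<phi> (last xs))"
proof (induction xs rule: path_edges.induct)
  case (1 x y xs)
  then have xy: "{x, y} \<in> E" by (simp add: gpath_def)
  show ?case
  proof (cases "xs = []")
    case True
    then show ?thesis using joined_edge[OF xy] by (simp add: trace_edge)
  next
    case False
    then have g: "gpath (y # xs)" using "1.prems" by (cases xs) (auto simp: gpath_def)
    obtain g h where g1: "arc g" "pathstart g = \<phi> x" "pathfinish g = \<phi> y" "path_image g = im {x, y}"
      and h: "arc h" "pathstart h = \<phi> y" "pathfinish h = \<phi> (last (y # xs))" "path_image h = trace (y # xs)"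
      using joined_edge[OF xy] "1.IH"[OF g] unfolding joined_by_def by auto
    have "{x, y} \<notin> path_edges (y # xs)" using path_edges_sub "1.prems" by (fastforce simp: gpath_def)
    then have "trace [x, y] \<inter> trace (y # xs) = \<phi> ` (set [x, y] \<inter> set (y # xs))"
      using g xy by (intro trace_Int) (auto simp: gpath_edge)
    also have "set [x, y] \<inter> set (y # xs) = {y}" using "1.prems" by (auto simp: gpath_def)
    finally have "path_image g \<inter> path_image h \<subseteq> {pathstart h}" using g1 h by (simp add: trace_edge)
    then have "arc (g +++ h)" using g1 h by (intro arc_join) auto
    moreover have "path_image (g +++ h) = trace (x # y # xs)"
      using g1 h by (simp add: path_image_join trace_def)
    ultimately show ?thesis unfolding joined_by_def using g1 h False
      by (intro exI[of _ "g +++ h"]) auto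
  qed
qed (auto simp: gpath_def)

text \<open>A cycle cut at two of its vertices. Disjointness of the edges is required separately,
  since otherwise two copies of one edge would qualify.\<close>

definition bigon :: "'a \<Rightarrow> 'a \<Rightarrow> 'a list \<Rightarrow> 'a list \<Rightarrow> bool" where
  "bigon a b p q \<longleftrightarrow> gpath p \<and> gpath q \<and> hd p = a \<and> hd q = a \<and> last p = b \<and> last q = b \<and>
     set p \<inter> set q = {a, b} \<and> path_edges p \<inter> path_edges q = {}"

lemma bigon_joined:
  assumes "bigon a b p q"
  shows "joined_by (trace p) (\<phi> a) (\<phi> b)" "joined_by (trace q) (\<phi> a) (\<phi> b)"
    "trace p \<inter> trace q = {\<phi> a, \<phi> b}"
  using assms joined_trace[of p] joined_trace[of q] trace_Int[of p q] by (auto simp: bigon_def)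

definition curve :: "'a list \<Rightarrow> 'a list \<Rightarrow> complex set" where
  "curve p q = trace p \<union> trace q"

lemma curve_vertex: "bigon a b p q \<Longrightarrow> x \<in> V \<Longrightarrow> \<phi> x \<in> curve p q \<longleftrightarrow> x \<in> set p \<union> set q"
  unfolding curve_def bigon_def using trace_vertex[of p x] trace_vertex[of q x] by auto

lemma Jordan_bigon:
  assumes "bigon a b p q"
  shows "inside (curve p q) \<noteq> {}" "open (inside (curve p q))" "connected (inside (curve p q))"
    "bounded (inside (curve p q))" "frontier (inside (curve p q)) = curve p q"
  using Jordan_joined_by[OF bigon_joined[OF assms]] unfolding curve_def by auto

lemma closure_inside_bigon:
  assumes "bigon a b p q"
  shows "closure (inside (curve p q)) = inside (curve p q) \<union> curve p q"
  using closure_inside_joined_by[OF bigon_joined[OF assms]] unfolding curve_def by (simp add: Un_assoc)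

lemma im_curve:
  assumes "bigon a b p q" "e \<in> E" "e \<notin> path_edges p \<union> path_edges q"
  shows "im e \<inter> curve p q = \<phi> ` (e \<inter> (set p \<union> set q))"
proof (intro equalityI subsetI)
  fix z assume "z \<in> im e \<inter> curve p q"
  then obtain f where f: "f \<in> path_edges p \<union> path_edges q" "z \<in> im f" "z \<in> im e"
    unfolding curve_def trace_def by blast
  then have "f \<in> E" "f \<noteq> e" "f \<subseteq> set p \<union> set q"
    using assms path_edges_sub unfolding bigon_def gpath_def by blast+
  then show "z \<in> \<phi> ` (e \<inter> (set p \<union> set q))" using im_Int[of e f] assms f by blast
next
  fix z assume "z \<in> \<phi> ` (e \<inter> (set p \<union> set q))"
  then obtain x where x: "z = \<phi> x" "x \<in> e" "x \<in> set p \<union> set q" by blast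
  have "x \<in> V" using edgeD(1) assms x by blast
  then show "z \<in> im e \<inter> curve p q" using x curve_vertex[OF assms(1)] im_vertex assms by blast
qed

end

locale outer_plane_graph = plane_graph +
  assumes outer: "\<phi> ` V \<subseteq> frontier (outside (drawing V E \<phi> \<gamma>))"
begin

lemma im_drawing: "e \<in> E \<Longrightarrow> im e \<subseteq> drawing V E \<phi> \<gamma>"
  unfolding drawing_def im_def by blast

lemma curve_drawing: "bigon a b p q \<Longrightarrow> curve p q \<subseteq> drawing V E \<phi> \<gamma>"
  using im_drawing by (fastforce simp: curve_def trace_def bigon_def gpath_def)

text \<open>The outside of the drawing lies in the outside of each of its cycles, so every vertex is
  a limit of points outside the cycle. The inside is open and disjoint from the outside, hence
  contains no such limit.\<close>

lemma vertex_not_inside: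
  assumes "bigon a b p q" "x \<in> V"
  shows "\<phi> x \<notin> inside (curve p q)"
proof
  let ?C = "curve p q"
  assume *: "\<phi> x \<in> inside ?C"
  have "\<phi> x \<in> closure (outside (drawing V E \<phi> \<gamma>))" using outer assms unfolding frontier_def by blast
  then have "\<phi> x \<in> closure (outside ?C)"
    using closure_mono[OF outside_mono[OF curve_drawing[OF assms(1)]]] by blast
  then have "inside ?C \<inter> closure (outside ?C) \<noteq> {}" using * by blast
  then show False
    using open_Int_closure_eq_empty[OF Jordan_bigon(2)[OF assms(1)], of "outside ?C"] by simp
qed

text \<open>Without its ends the edge is connected and misses the cycle, so it is inside as a whole.
  Its ends are limits of inside points but, being vertices, are not inside; hence they lie on the
  cycle.\<close>

lemma edge_inside:
  assumes b: "bigon a b p q" and e: "e \<in> E" "im e \<inter> inside (curve p q) \<noteq> {}"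
  shows "e \<subseteq> set p \<union> set q" "im e - \<phi> ` e \<subseteq> inside (curve p q)"
    "e \<notin> path_edges p \<union> path_edges q"
proof -
  let ?C = "curve p q"
  show ne: "e \<notin> path_edges p \<union> path_edges q"
  proof
    assume "e \<in> path_edges p \<union> path_edges q"
    then have "im e \<subseteq> ?C" unfolding curve_def trace_def by blast
    then show False using e inside_no_overlap[of ?C] by blast
  qed
  obtain x y where xy: "e = {x, y}" "x \<in> V" "y \<in> V" "joined_by (im e) (\<phi> x) (\<phi> y)"
    using joined_edge'[OF e(1)] by blast
  note j = joined_by_facts[OF xy(4)]
  have "\<phi> x \<notin> inside ?C" "\<phi> y \<notin> inside ?C" using vertex_not_inside[OF b] xy by auto
  then have "(im e - {\<phi> x, \<phi> y}) \<inter> inside ?C \<noteq> {}" using e by blast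
  moreover have "(im e - {\<phi> x, \<phi> y}) \<inter> ?C = {}" using im_curve[OF b e(1) ne] xy by blast
  ultimately have sub: "im e - {\<phi> x, \<phi> y} \<subseteq> inside ?C"
    using connected_subset_inside j(6) by blast
  then show "im e - \<phi> ` e \<subseteq> inside ?C" using xy by auto
  have "im e \<subseteq> closure (im e - {\<phi> x, \<phi> y})"
  proof -
    obtain g where g: "arc g" "pathstart g = \<phi> x" "pathfinish g = \<phi> y" "path_image g = im e"
      using xy(4) by (auto simp: joined_by_def)
    have "im e - {\<phi> x, \<phi> y} = g ` {0<..<1}"
      using simple_path_endless[OF arc_imp_simple_path[OF g(1)]] g by simp
    moreover have "g ` closure {0<..<1} \<subseteq> closure (g ` {0<..<1})"
      by (rule image_closure_subset) (use g in \<open>auto simp: arc_def path_def closure_subset\<close>)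
    ultimately show ?thesis using g by (simp add: path_image_def)
  qed
  also have "\<dots> \<subseteq> closure (inside ?C)" using sub by (rule closure_mono)
  also have "\<dots> = inside ?C \<union> ?C" by (rule closure_inside_bigon[OF b])
  finally have "\<phi> x \<in> ?C" "\<phi> y \<in> ?C"
    using j(2,3) \<open>\<phi> x \<notin> inside ?C\<close> \<open>\<phi> y \<notin> inside ?C\<close> by blast+
  then show "e \<subseteq> set p \<union> set q" using curve_vertex[OF b] xy by auto
qed

end

lemma path_edges_append2:
  "xs \<noteq> [] \<Longrightarrow> ys \<noteq> [] \<Longrightarrow> path_edges (xs @ ys) = path_edges xs \<union> {{last xs, hd ys}} \<union> path_edges ys"
proof (induction xs rule: path_edges.induct)
  case ("2_2" v)
  then show ?case by (cases ys) auto
qed auto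

lemma path_edges_ends:
  assumes "distinct xs" "{hd xs, last xs} \<in> path_edges xs"
  shows "xs = [hd xs, last xs]"
proof -
  obtain x y zs where xs: "xs = x # y # zs"
    using assms(2) by (cases xs rule: path_edges.cases) auto
  have "{x, last xs} \<notin> path_edges (y # zs)" using path_edges_sub[of "{x, last xs}" "y # zs"] assms(1) xs by auto
  then have "{x, last xs} = {x, y}" using assms(2) xs by auto
  then have "last (y # zs) = y" using xs assms(1) by (auto simp: doubleton_eq_iff)
  then have "zs = []" using assms(1) xs by (metis distinct.simps(2) last_ConsR last_in_set)
  then show ?thesis using xs by simp
qed

context plane_graph
begin

text \<open>A shared edge has its ends in \<open>{a, b}\<close>, so in both paths it joins the first
  vertex to the last, which forces both paths to be that single edge.\<close>

lemma bigonI: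
  assumes p: "gpath p" "hd p = a" "last p = b" and q: "gpath q" "hd q = a" "last q = b"
    and pq: "set p \<inter> set q = {a, b}" "p \<noteq> [a, b] \<or> q \<noteq> [a, b]"
  shows "bigon a b p q"
proof -
  have "path_edges p \<inter> path_edges q = {}"
  proof (rule ccontr)
    assume "path_edges p \<inter> path_edges q \<noteq> {}"
    then obtain e where e: "e \<in> path_edges p" "e \<in> path_edges q" by blast
    then have "e \<subseteq> {a, b}" using path_edges_sub[OF e(1)] path_edges_sub[OF e(2)] pq(1) by blast
    moreover have "e \<in> E" using e p(1) by (auto simp: gpath_def)
    then have "card e = 2" by (rule edgeD(2))
    ultimately have "e = {a, b}" by (intro card_seteq) (auto simp: card_insert_if)
    then show False using e path_edges_ends[of p] path_edges_ends[of q] p q pq(2) by (auto simp: gpath_def)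
  qed
  then show ?thesis using assms unfolding bigon_def by blast
qed

lemma gpath_split:
  assumes "gpath (ps @ w # qs)" "ps \<noteq> []" "qs \<noteq> []"
  shows "gpath (ps @ [w])" "gpath (w # qs)"
proof -
  have "length ps > 0" "length qs > 0" using assms by auto
  then show "gpath (ps @ [w])" "gpath (w # qs)"
    using assms(1) path_edges_append[of ps w qs] by (auto simp: gpath_def Suc_le_eq)
qed

lemma trace_append: "trace (ps @ w # qs) = trace (ps @ [w]) \<union> trace (w # qs)"
  unfolding trace_def path_edges_append[of ps w qs] by blast

end

section \<open>Cutting a cycle along the triangle at its root edge\<close>

locale triangulated_plane_graph = outer_plane_graph +
  assumes faces: "\<forall>F \<in> components (- drawing V E \<phi> \<gamma>). bounded F \<longrightarrow> triangle_face E \<gamma> F"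
begin

lemma finite_VE: "finite V" "finite E"
proof -
  show "finite V" using simple by (simp add: simple_graph_def)
  then show "finite E" using finite_subset[of E "Pow V"] edgeD(1) by auto
qed

text \<open>Take a face on the inner side of the edge \<open>{u, v}\<close>, close to a point
  \<open>x\<close> of it that is not an end. Near \<open>x\<close> the drawing consists of this edge
  only, so the edge is a side of the triangular face. The third corner lies in the closure of the
  inside but not inside, hence on the cycle.\<close>

lemma face_triangle:
  assumes b: "bigon u v [u, v] xs"
  shows "\<exists>w \<in> set xs - {u, v}. {u, w} \<in> E \<and> {w, v} \<in> E \<and>
    im {u, w} \<subseteq> closure (inside (curve [u, v] xs)) \<and> im {w, v} \<subseteq> closure (inside (curve [u, v] xs))"
proof -
  let ?C = "curve [u, v] xs" and ?D = "drawing V E \<phi> \<gamma>" and ?e = "{u, v}"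
  have e: "?e \<in> E" using b by (simp add: bigon_def gpath_edge)
  have uv: "u \<in> V" "v \<in> V" "u \<noteq> v" using edgeD(3)[OF e] by auto
  have eC: "im ?e \<subseteq> ?C" by (simp add: curve_def trace_edge)
  \<comment> \<open>The drawing without the root edge; it is compact, so a whole ball around
    \<open>x\<close> misses it.\<close>
  define D' where "D' = \<phi> ` V \<union> (\<Union>f\<in>E - {?e}. im f)"
  have imc: "compact (im f)" if "f \<in> E" for f
    using joined_edge'[OF that] joined_by_facts(4) by blast
  have "compact (\<phi> ` V)" using finite_VE by (intro finite_imp_compact) simp
  moreover have "compact (\<Union>f\<in>E - {?e}. im f)" using finite_VE imc by (intro compact_UN) auto
  ultimately have "compact D'" unfolding D'_def by (rule compact_Un)
  then have op: "open (- D')" by (simp add: compact_imp_closed open_Compl)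
  have D: "?D = D' \<union> im ?e" unfolding drawing_def D'_def im_def using e by blast
  obtain x where x: "x \<in> im ?e" "x \<noteq> \<phi> u" "x \<noteq> \<phi> v"
    using joined_by_facts(7)[OF joined_edge[OF e]] by blast
  have "x \<notin> D'"
  proof
    assume "x \<in> D'"
    then consider z where "z \<in> V" "x = \<phi> z" | f where "f \<in> E" "f \<noteq> ?e" "x \<in> im f"
      unfolding D'_def by blast
    then show False
    proof cases
      case 1 then show False using im_vertex[OF e, of z] x by auto
    next
      case 2
      then have "x \<in> \<phi> ` (f \<inter> ?e)" using im_Int[OF 2(1) e 2(2)] x(1) by blast
      then show False using x by blast
    qed
  qed
  then obtain r where r: "r > 0" "ball x r \<subseteq> - D'" using op open_contains_ball by blast
  have "x \<in> closure (inside ?C)" using closure_inside_bigon[OF b] eC x by blast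
  then obtain p where p: "p \<in> inside ?C" "p \<in> ball x r"
    using r(1) by (metis closure_approachable dist_commute mem_ball)
  have pD: "p \<in> - ?D" using p r eC inside_no_overlap[of ?C] unfolding D by blast
  define F where "F = connected_component_set (- ?D) p"
  have F: "F \<in> components (- ?D)" unfolding F_def using pD by (rule componentsI)
  have pF: "p \<in> F" unfolding F_def using pD by simp
  have "F \<subseteq> inside ?C"
  proof (rule connected_subset_inside)
    show "connected F" using F by (rule in_components_connected)
    show "F \<inter> ?C = {}" using in_components_subset[OF F] curve_drawing[OF b] by blast
    show "F \<inter> inside ?C \<noteq> {}" using pF p by blast
  qed
  then have clF: "closure F \<subseteq> closure (inside ?C)" and "bounded F"
    using closure_mono bounded_subset[OF Jordan_bigon(4)[OF b]] by blast+
  then have "triangle_face E \<gamma> F" using faces F by blast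
  then obtain a b' c where abc: "a \<noteq> b'" "b' \<noteq> c" "a \<noteq> c" "{a, b'} \<in> E" "{b', c} \<in> E" "{a, c} \<in> E"
    and fr: "frontier F = im {a, b'} \<union> im {b', c} \<union> im {a, c}"
    unfolding triangle_face_def im_def by blast
  \<comment> \<open>The ball contains \<open>p\<close> in \<open>F\<close> and \<open>x\<close>
    outside \<open>F\<close>, so it meets the frontier, and within the ball only the root edge can
    supply such a point.\<close>
  have "ball x r \<inter> frontier F \<noteq> {}"
  proof (rule connected_Int_frontier)
    show "ball x r \<inter> F \<noteq> {}" using p pF by blast
    have "x \<notin> F" using in_components_subset[OF F] D x(1) by blast
    then show "ball x r - F \<noteq> {}" using r(1) by (metis DiffI centre_in_ball empty_iff)
  qed simp
  then obtain z g where z: "z \<in> ball x r" "z \<in> im g" "g \<in> {{a, b'}, {b', c}, {a, c}}"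
    unfolding fr by blast
  have "g \<in> E" using z(3) abc by blast
  then have "g = ?e" using z(1,2) r(2) unfolding D'_def by blast
  then have "?e \<in> {{a, b'}, {b', c}, {a, c}}" using z(3) by blast
  then obtain w where w: "w \<noteq> u" "w \<noteq> v" "{u, w} \<in> E" "{w, v} \<in> E" "im {u, w} \<subseteq> frontier F" "im {w, v} \<subseteq> frontier F"
  proof -
    assume *: "\<And>w. w \<noteq> u \<Longrightarrow> w \<noteq> v \<Longrightarrow> {u, w} \<in> E \<Longrightarrow> {w, v} \<in> E \<Longrightarrow> im {u, w} \<subseteq> frontier F \<Longrightarrow>
       im {w, v} \<subseteq> frontier F \<Longrightarrow> thesis"
    consider "u = a" "v = b'" | "u = b'" "v = a" | "u = b'" "v = c" | "u = c" "v = b'" | "u = a" "v = c" | "u = c" "v = a"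
      using \<open>?e \<in> {{a, b'}, {b', c}, {a, c}}\<close> by (auto simp: doubleton_eq_iff)
    then show thesis
    proof cases
      case 1 then show thesis using *[of c] abc fr by (auto simp: insert_commute)
    next
      case 2 then show thesis using *[of c] abc fr by (auto simp: insert_commute)
    next
      case 3 then show thesis using *[of a] abc fr by (auto simp: insert_commute)
    next
      case 4 then show thesis using *[of a] abc fr by (auto simp: insert_commute)
    next
      case 5 then show thesis using *[of b'] abc fr by (auto simp: insert_commute)
    next
      case 6 then show thesis using *[of b'] abc fr by (auto simp: insert_commute)
    qed
  qed
  have "frontier F \<subseteq> closure (inside ?C)" using clF unfolding frontier_def by blast
  then have cl: "im {u, w} \<subseteq> closure (inside ?C)" "im {w, v} \<subseteq> closure (inside ?C)" using w by blast+
  have wV: "w \<in> V" using edgeD(3)[OF w(3)] by blast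
  have "\<phi> w \<in> im {u, w}" using im_vertex[OF w(3) wV] by blast
  then have "\<phi> w \<in> ?C" using cl closure_inside_bigon[OF b] vertex_not_inside[OF b wV] by blast
  then have "w \<in> set xs" using curve_vertex[OF b wV] w by auto
  then show ?thesis using w cl by blast
qed

text \<open>For \<open>xs = [u, v]\<close> the curve is a single arc with empty inside, so just the
  root edge remains.\<close>

definition edges_within :: "'a \<Rightarrow> 'a \<Rightarrow> 'a list \<Rightarrow> 'a set set" where
  "edges_within u v xs = insert {u, v} (path_edges xs) \<union> {e \<in> E. im e \<inter> inside (curve [u, v] xs) \<noteq> {}}"

text \<open>Two theta curves: \<open>{u, w}\<close> splits the inside of the cycle into
  \<open>?I1\<close> and \<open>?J\<close>, then \<open>{w, v}\<close> splits \<open>?J\<close> into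
  \<open>?I2\<close> and the triangle \<open>?T\<close>. Edges drawn inside avoid \<open>?T\<close>
  and do not cross the two chords, so each runs in \<open>?I1\<close> or \<open>?I2\<close> or is
  one of the chords. If \<open>{u, w}\<close> or \<open>{w, v}\<close> is a cycle edge, the
  corresponding split is trivial.\<close>

lemma triangulate_step:
  assumes b: "bigon u v [u, v] xs" and xs: "xs = ps @ w # qs" and w: "w \<noteq> u" "w \<noteq> v"
    and uw: "{u, w} \<in> E" "im {u, w} \<subseteq> closure (inside (curve [u, v] xs))"
    and wv: "{w, v} \<in> E" "im {w, v} \<subseteq> closure (inside (curve [u, v] xs))"
  shows "edges_within u v xs = insert {u, v} (edges_within u w (ps @ [w]) \<union> edges_within w v (w # qs))"
proof -
  define xs1 xs2 where xs12: "xs1 = ps @ [w]" "xs2 = w # qs"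
  \<comment> \<open>The rest of the cycle as a path from \<open>u\<close> to \<open>w\<close>: over
    the root edge to \<open>v\<close>, then back along the second half of \<open>xs\<close>.\<close>
  define r where "r = u # rev xs2"
  let ?I = "inside (curve [u, v] xs)"
  have gxs: "gpath xs" "hd xs = u" "last xs = v" and uv: "{u, v} \<in> E" "u \<noteq> v"
    using b edgeD(3)[of u v] by (auto simp: bigon_def gpath_edge)
  have ne: "ps \<noteq> []" "qs \<noteq> []" using gxs w xs by auto
  have g1: "gpath xs1" "hd xs1 = u" "last xs1 = w" and g2: "gpath xs2" "hd xs2 = w" "last xs2 = v"
    using gpath_split[of ps w qs] gxs ne unfolding xs xs12 by auto
  have disj: "set xs1 \<inter> set xs2 = {w}" using gxs(1) unfolding xs xs12 gpath_def by auto
  have in1: "u \<in> set xs1" "w \<in> set xs1" and in2: "w \<in> set xs2" "v \<in> set xs2"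
    using g1 g2 xs12 ne by (metis hd_in_set last_in_set snoc_eq_iff_butlast list.distinct(1))+
  have ni: "u \<notin> set xs2" "v \<notin> set xs1" using disj in1 in2 w by (metis IntI singletonD)+
  obtain t where t: "rev xs2 = v # t" using g2 xs12 by (metis hd_rev list.exhaust_sel rev_is_Nil_conv list.distinct(1))
  have er: "path_edges r = insert {u, v} (path_edges xs2)"
    unfolding r_def using t path_edges_rev[of xs2] by simp
  have tr: "trace r = im {u, v} \<union> trace xs2" unfolding trace_def er by simp
  have gr: "gpath r" "hd r = u" "last r = w"
    using g2 ni er uv unfolding r_def gpath_def by (auto simp: last_rev)
  have sr: "set r = insert u (set xs2)" by (simp add: r_def)
  have tc: "curve [u, v] xs = trace xs1 \<union> trace r"
    unfolding curve_def trace_edge tr xs trace_append[of ps w qs] xs12 by blast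
  have ex: "path_edges xs = path_edges xs1 \<union> path_edges xs2"
    unfolding xs xs12 by (rule path_edges_append)
  let ?J = "inside (trace r \<union> im {u, w})" and ?I1 = "inside (curve [u, w] xs1)"
  let ?I2 = "inside (curve [w, v] xs2)" and ?T = "inside (im {u, v} \<union> im {u, w} \<union> im {w, v})"
  have chord: "z \<in> ?I" if z: "z \<in> im f" "z \<notin> \<phi> ` f" and f: "f \<in> E" "im f \<subseteq> closure ?I"
      "f \<notin> path_edges [u, v] \<union> path_edges xs" for z f
  proof -
    have "z \<notin> curve [u, v] xs" using im_curve[OF b f(1,3)] z by blast
    then show ?thesis using closure_inside_bigon[OF b] f(2) z(1) by blast
  qed
  have endless: "\<exists>z. z \<in> im f \<and> z \<notin> \<phi> ` f" if f: "f \<in> E" for f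
  proof -
    obtain x y where "f = {x, y}" "joined_by (im f) (\<phi> x) (\<phi> y)" using joined_edge'[OF f] by blast
    then have "\<phi> ` f = {\<phi> x, \<phi> y}" "im f - {\<phi> x, \<phi> y} \<noteq> {}" using joined_by_facts(7) by auto
    then show ?thesis by blast
  qed
  have uwe: "{u, w} \<notin> path_edges [u, v] \<union> path_edges xs2" "{w, v} \<notin> path_edges [u, v] \<union> path_edges xs1"
    using path_edges_sub[of "{u, w}" xs2] path_edges_sub[of "{w, v}" xs1] ni w by (auto simp: doubleton_eq_iff)
  have I: "?I \<subseteq> ?I1 \<union> ?J \<union> im {u, w}" "?I1 \<subseteq> ?I" "?J \<subseteq> ?I"
    "{u, w} \<in> path_edges xs1 \<or> im {u, w} \<inter> ?I \<noteq> {}" "?I1 = {} \<or> bigon u w [u, w] xs1"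
  proof -
    have "(?I \<subseteq> ?I1 \<union> ?J \<union> im {u, w} \<and> ?I1 \<subseteq> ?I \<and> ?J \<subseteq> ?I) \<and>
      ({u, w} \<in> path_edges xs1 \<or> im {u, w} \<inter> ?I \<noteq> {}) \<and> (?I1 = {} \<or> bigon u w [u, w] xs1)"
    proof (cases "xs1 = [u, w]")
      case True
      have "?I1 = {}" unfolding curve_def True trace_edge using joined_by_facts(8)[OF joined_edge[OF uw(1)]] by simp
      moreover have "?I = ?J" unfolding tc True trace_edge by (simp add: Un_commute)
      ultimately show ?thesis using True by auto
    next
      case False
      have b1: "bigon u w [u, w] xs1"
        by (rule bigonI) (use g1 in1 uw False in \<open>auto simp: gpath_edge\<close>)
      have b2: "bigon u w xs1 r"
      proof (rule bigonI)
        show "set xs1 \<inter> set r = {u, w}" using disj in1 sr by blast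
      qed (use g1 gr False in auto)
      have "{u, w} \<notin> path_edges r" using uwe er by auto
      then have b3: "bigon u w r [u, w]"
        using gr uw sr in2 w ni by (auto simp: bigon_def gpath_edge)
      have n: "{u, w} \<notin> path_edges xs1" using b1 by (auto simp: bigon_def)
      obtain z where z: "z \<in> im {u, w}" "z \<notin> \<phi> ` {u, w}" using endless[OF uw(1)] by blast
      have "{u, w} \<notin> path_edges [u, v] \<union> path_edges xs" using uwe n ex by blast
      then have zI: "z \<in> ?I" using chord[OF z uw] by blast
      have "inside (trace xs1 \<union> trace r) = inside (trace xs1 \<union> im {u, w}) \<union> ?J \<union> (im {u, w} - {\<phi> u, \<phi> w})"
      proof (rule theta_split)
        show "joined_by (trace xs1) (\<phi> u) (\<phi> w)" "joined_by (trace r) (\<phi> u) (\<phi> w)"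
          "trace xs1 \<inter> trace r = {\<phi> u, \<phi> w}" using bigon_joined[OF b2] by auto
        show "joined_by (im {u, w}) (\<phi> u) (\<phi> w)" by (rule joined_edge[OF uw(1)])
        show "trace xs1 \<inter> im {u, w} = {\<phi> u, \<phi> w}"
          using bigon_joined(3)[OF b1] by (simp add: trace_edge Int_commute)
        show "trace r \<inter> im {u, w} = {\<phi> u, \<phi> w}" using bigon_joined(3)[OF b3] by (simp add: trace_edge)
        show "im {u, w} \<inter> inside (trace xs1 \<union> trace r) \<noteq> {}" using z zI tc by auto
      qed
      moreover have "inside (trace xs1 \<union> im {u, w}) = ?I1"
        unfolding curve_def trace_edge by (simp add: Un_commute)
      ultimately have "?I = ?I1 \<union> ?J \<union> (im {u, w} - {\<phi> u, \<phi> w})" unfolding tc by simp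
      then show ?thesis using b1 z zI by blast
    qed
    then show "?I \<subseteq> ?I1 \<union> ?J \<union> im {u, w}" "?I1 \<subseteq> ?I" "?J \<subseteq> ?I"
      "{u, w} \<in> path_edges xs1 \<or> im {u, w} \<inter> ?I \<noteq> {}" "?I1 = {} \<or> bigon u w [u, w] xs1" by blast+
  qed
  have tri: "gpath [w, u, v]" "trace [w, u, v] = im {u, w} \<union> im {u, v}"
    using uw uv w by (auto simp: gpath_def trace_def insert_commute)
  have bT: "bigon w v [w, v] [w, u, v]"
    by (rule bigonI) (use tri wv w uv in \<open>auto simp: gpath_edge\<close>)
  have J: "?J \<subseteq> ?I2 \<union> ?T \<union> im {w, v}" "?I2 \<subseteq> ?J" "{w, v} \<in> path_edges xs2 \<or> im {w, v} \<inter> ?I \<noteq> {}"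
  proof -
    have "(?J \<subseteq> ?I2 \<union> ?T \<union> im {w, v} \<and> ?I2 \<subseteq> ?J) \<and> ({w, v} \<in> path_edges xs2 \<or> im {w, v} \<inter> ?I \<noteq> {})"
    proof (cases "xs2 = [w, v]")
      case True
      have "?I2 = {}" unfolding curve_def True trace_edge using joined_by_facts(8)[OF joined_edge[OF wv(1)]] by simp
      moreover have "?J = ?T" unfolding tr True trace_edge by (simp add: Un_ac)
      ultimately show ?thesis using True by auto
    next
      case False
      have b1: "bigon w v [w, v] xs2"
        by (rule bigonI) (use g2 in2 wv False in \<open>auto simp: gpath_edge\<close>)
      have b2: "bigon w v xs2 [w, u, v]"
        by (rule bigonI) (use g2 in2 tri ni in auto)
      have n: "{w, v} \<notin> path_edges xs2" using b1 by (auto simp: bigon_def)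
      obtain z where z: "z \<in> im {w, v}" "z \<notin> \<phi> ` {w, v}" using endless[OF wv(1)] by blast
      have "{w, v} \<notin> path_edges [u, v] \<union> path_edges xs" using uwe n ex by blast
      then have zI: "z \<in> ?I" using chord[OF z wv] by blast
      have "z \<notin> im {u, w}"
      proof
        assume "z \<in> im {u, w}"
        moreover have "{u, w} \<noteq> {w, v}" using w uv by (auto simp: doubleton_eq_iff)
        ultimately have "z \<in> \<phi> ` ({u, w} \<inter> {w, v})" using im_Int[OF uw(1) wv(1)] z(1) by blast
        then show False using z(2) by blast
      qed
      \<comment> \<open>The second chord must not lie beyond the first: an edge that enters
        \<open>?I1\<close> has both ends on that smaller cycle, and \<open>v\<close> is not on
        it.\<close>
      moreover have "z \<notin> ?I1"
      proof
        assume "z \<in> ?I1"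
        then have "bigon u w [u, w] xs1" "im {w, v} \<inter> ?I1 \<noteq> {}" using I(5) z by blast+
        then have "{w, v} \<subseteq> set [u, w] \<union> set xs1" using edge_inside(1) wv by blast
        then show False using ni w uv by auto
      qed
      ultimately have zJ: "z \<in> ?J" using zI I(1) by blast
      have J': "?J = inside (trace xs2 \<union> trace [w, u, v])" unfolding tr tri by (simp add: Un_ac)
      have "inside (trace xs2 \<union> trace [w, u, v]) = inside (trace xs2 \<union> im {w, v}) \<union>
          inside (trace [w, u, v] \<union> im {w, v}) \<union> (im {w, v} - {\<phi> w, \<phi> v})"
      proof (rule theta_split)
        show "joined_by (trace xs2) (\<phi> w) (\<phi> v)" "joined_by (trace [w, u, v]) (\<phi> w) (\<phi> v)"
          "trace xs2 \<inter> trace [w, u, v] = {\<phi> w, \<phi> v}" using bigon_joined[OF b2] by auto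
        show "joined_by (im {w, v}) (\<phi> w) (\<phi> v)" by (rule joined_edge[OF wv(1)])
        show "trace xs2 \<inter> im {w, v} = {\<phi> w, \<phi> v}"
          using bigon_joined(3)[OF b1] by (simp add: trace_edge Int_commute)
        show "trace [w, u, v] \<inter> im {w, v} = {\<phi> w, \<phi> v}"
          using bigon_joined(3)[OF bT] by (simp add: trace_edge Int_commute)
        show "im {w, v} \<inter> inside (trace xs2 \<union> trace [w, u, v]) \<noteq> {}" using z zJ J' by auto
      qed
      moreover have "inside (trace xs2 \<union> im {w, v}) = ?I2"
        unfolding curve_def trace_edge by (simp add: Un_commute)
      moreover have "inside (trace [w, u, v] \<union> im {w, v}) = ?T" unfolding tri by (simp add: Un_ac)
      ultimately have "?J = ?I2 \<union> ?T \<union> (im {w, v} - {\<phi> w, \<phi> v})" using J' by simp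
      then show ?thesis using z zI by blast
    qed
    then show "?J \<subseteq> ?I2 \<union> ?T \<union> im {w, v}" "?I2 \<subseteq> ?J" "{w, v} \<in> path_edges xs2 \<or> im {w, v} \<inter> ?I \<noteq> {}"
      by blast+
  qed
  \<comment> \<open>An edge inside this cycle would join two of its three vertices without being a
    cycle edge, but all three pairs are cycle edges.\<close>
  have T: "im e \<inter> ?T = {}" if eE: "e \<in> E" for e
  proof (rule ccontr)
    assume ne: "im e \<inter> ?T \<noteq> {}"
    have "?T = inside (curve [w, v] [w, u, v])" unfolding curve_def trace_edge tri by (simp add: Un_ac)
    then have "e \<subseteq> {u, v, w}" "e \<noteq> {w, v}" "e \<noteq> {w, u}" "e \<noteq> {u, v}"
      using edge_inside(1,3)[OF bT eE] ne by auto
    moreover obtain x y where "e = {x, y}" "x \<noteq> y" using edgeD(2)[OF eE] by (metis card_2_iff)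
    ultimately show False by (auto simp: insert_commute)
  qed
  \<comment> \<open>Distinct edges meet in vertices only, and no vertex is inside.\<close>
  have same: "e = f" if ef: "e \<in> E" "f \<in> E" and z: "z \<in> im e" "z \<in> im f" "z \<in> ?I" for e f z
  proof (rule ccontr)
    assume "e \<noteq> f"
    then obtain x where "x \<in> e" "z = \<phi> x" using im_Int[OF ef] z(1,2) by blast
    then show False using vertex_not_inside[OF b, of x] edgeD(1)[OF ef(1)] z(3) by blast
  qed
  have "e \<in> insert {u, v} (edges_within u w xs1 \<union> edges_within w v xs2)" if e: "e \<in> edges_within u v xs" for e
  proof (cases "e \<in> E \<and> im e \<inter> ?I \<noteq> {}")
    case True
    then obtain z where z: "e \<in> E" "z \<in> im e" "z \<in> ?I" by blast
    then consider "z \<in> ?I1" | "z \<in> im {u, w}" | "z \<in> ?I2" | "z \<in> im {w, v}"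
      using I(1) J(1) T[OF z(1)] by blast
    then show ?thesis
    proof cases
      case 1 then show ?thesis using z unfolding edges_within_def by blast
    next
      case 2 then have "e = {u, w}" using same[OF z(1) uw(1) z(2) _ z(3)] by blast
      then show ?thesis unfolding edges_within_def by blast
    next
      case 3 then show ?thesis using z unfolding edges_within_def by blast
    next
      case 4 then have "e = {w, v}" using same[OF z(1) wv(1) z(2) _ z(3)] by blast
      then show ?thesis unfolding edges_within_def by blast
    qed
  next
    case False
    then show ?thesis using e ex unfolding edges_within_def by blast
  qed
  moreover have "e \<in> edges_within u v xs" if "e \<in> insert {u, v} (edges_within u w xs1 \<union> edges_within w v xs2)" for e
    using that I(2,3,4) J(2,3) uw(1) wv(1) ex unfolding edges_within_def by blast
  ultimately show ?thesis unfolding xs12 by blast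
qed

lemma triangulate:
  "gpath xs \<Longrightarrow> hd xs = u \<Longrightarrow> last xs = v \<Longrightarrow> {u, v} \<in> E \<Longrightarrow>
    \<exists>L. rooted_mop u v (set xs) (edges_within u v xs) L"
proof (induction "length xs" arbitrary: xs u v rule: less_induct)
  case less
  have uv: "u \<noteq> v" "gpath [u, v]" using edgeD(3)[OF less.prems(4)] less.prems(4) by (auto simp: gpath_edge)
  show ?case
  proof (cases "xs = [u, v]")
    case True
    have "inside (curve [u, v] xs) = {}"
      using joined_by_facts(8)[OF joined_edge[OF less.prems(4)]] by (simp add: curve_def True trace_edge)
    then have "edges_within u v xs = {{u, v}}" by (simp add: edges_within_def True)
    then show ?thesis using rooted_mop.edge[OF uv(1)] True by auto
  next
    case False
    have uvs: "u \<in> set xs" "v \<in> set xs" 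
    proof -
      have "xs \<noteq> []" using less.prems(1) by (auto simp: gpath_def)
      then show "u \<in> set xs" "v \<in> set xs" using less.prems(2,3) by auto
    qed
    have b: "bigon u v [u, v] xs"
      by (rule bigonI) (use less.prems uv uvs False in auto)
    obtain w where w: "w \<in> set xs" "w \<noteq> u" "w \<noteq> v" "{u, w} \<in> E" "{w, v} \<in> E"
      "im {u, w} \<subseteq> closure (inside (curve [u, v] xs))" "im {w, v} \<subseteq> closure (inside (curve [u, v] xs))"
      using face_triangle[OF b] by blast
    obtain ps qs where xs: "xs = ps @ w # qs" using split_list[OF w(1)] by blast
    have ne: "ps \<noteq> []" "qs \<noteq> []" using less.prems w xs by auto
    note g = gpath_split[OF less.prems(1)[unfolded xs] ne]
    obtain L1 where L1: "rooted_mop u w (set (ps @ [w])) (edges_within u w (ps @ [w])) L1"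
      using less.hyps[OF _ g(1) _ _ w(4)] less.prems(2) xs ne by auto
    obtain L2 where L2: "rooted_mop w v (set (w # qs)) (edges_within w v (w # qs)) L2"
      using less.hyps[OF _ g(2) _ _ w(5)] less.prems(3) xs ne by auto
    have "set (ps @ [w]) \<inter> set (w # qs) = {w}" using less.prems(1) unfolding xs gpath_def by auto
    from rooted_mop.glue[OF L1 L2 this] show ?thesis
      using triangulate_step[OF b xs w(2,3,4,6,5,7)] unfolding xs by (auto simp: Un_insert_right)
  qed
qed

end

section \<open>Ears and Hamiltonicity\<close>

context plane_graph
begin

definition gcycle :: "'a list \<Rightarrow> bool" where
  "gcycle xs \<longleftrightarrow> distinct xs \<and> 3 \<le> length xs \<and> path_edges xs \<subseteq> E \<and> {last xs, hd xs} \<in> E"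

definition cycle_edges :: "'a list \<Rightarrow> 'a set set" where
  "cycle_edges xs = insert {last xs, hd xs} (path_edges xs)"

lemma cycle_rotate:
  assumes "gcycle xs" "c \<in> set xs"
  obtains ys where "gcycle (c # ys)" "set (c # ys) = set xs" "length (c # ys) = length xs"
    "cycle_edges (c # ys) = cycle_edges xs"
proof -
  obtain p q where xs: "xs = p @ c # q" using split_list[OF assms(2)] by blast
  have ce: "cycle_edges (c # q @ p) = cycle_edges xs"
  proof (cases "p = []")
    case True then show ?thesis by (simp add: xs)
  next
    case False
    then have "path_edges (c # q @ p) = path_edges (c # q) \<union> {{last (c # q), hd p}} \<union> path_edges p"
      using path_edges_append2[of "c # q" p] by simp
    moreover have "path_edges xs = path_edges p \<union> {{last p, c}} \<union> path_edges (c # q)"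
      using path_edges_append2[of p "c # q"] False by (simp add: xs)
    ultimately show ?thesis using False by (auto simp: cycle_edges_def xs insert_commute)
  qed
  have "distinct (c # q @ p)" "3 \<le> length (c # q @ p)" using assms(1) by (auto simp: gcycle_def xs)
  moreover have "cycle_edges (c # q @ p) \<subseteq> E" using assms(1) unfolding ce by (simp add: gcycle_def cycle_edges_def)
  ultimately have "gcycle (c # q @ p)" by (simp add: gcycle_def cycle_edges_def)
  then show thesis using that[of "q @ p"] ce by (auto simp: xs)
qed

lemma cycle_arcs:
  assumes c: "gcycle (c # p @ c' # q)"
  shows "bigon c c' (c # p @ [c']) (c # rev q @ [c'])"
    "path_edges (c # p @ [c']) \<union> path_edges (c # rev q @ [c']) = cycle_edges (c # p @ c' # q)"
proof -
  let ?A = "c # p @ [c']" and ?B = "c # rev q @ [c']"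
  have "path_edges ?B = path_edges (rev ?B)" by (rule path_edges_rev[symmetric])
  also have "\<dots> = path_edges ((c' # q) @ [c])" by simp
  also have "\<dots> = insert {last (c' # q), c} (path_edges (c' # q))"
    using path_edges_append2[of "c' # q" "[c]"] by simp
  finally have B: "path_edges ?B = insert {last (c' # q), c} (path_edges (c' # q))" .
  have AB: "path_edges (c # p @ c' # q) = path_edges ?A \<union> path_edges (c' # q)"
    using path_edges_append[of "c # p" c' q] by simp
  show ce: "path_edges ?A \<union> path_edges ?B = cycle_edges (c # p @ c' # q)"
    unfolding cycle_edges_def AB B by auto
  have sub: "cycle_edges (c # p @ c' # q) \<subseteq> E" using c by (auto simp: gcycle_def cycle_edges_def)
  show "bigon c c' ?A ?B"
  proof (rule bigonI)
    show "gpath ?A" "gpath ?B" using c ce sub unfolding gpath_def gcycle_def by auto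
    show "set ?A \<inter> set ?B = {c, c'}" using c unfolding gcycle_def by auto
    show "?A \<noteq> [c, c'] \<or> ?B \<noteq> [c, c']" using c unfolding gcycle_def by auto
  qed auto
qed

lemma curve_edges: "curve p q = \<Union> (im ` (path_edges p \<union> path_edges q))"
  unfolding curve_def trace_def by blast

end

text \<open>Built backwards from \<open>t\<close>: a new vertex in \<open>T\<close> restarts the
  path, a vertex already on it cuts off the detour. Stopping at the first vertex of \<open>T\<close>
  is what makes an ear meet a cycle only at its ends.\<close>

lemma rtrancl_simple_path:
  assumes "(x, t) \<in> {(x, y). {x, y} \<in> F}\<^sup>*" "t \<in> T"
  shows "\<exists>ys. ys \<noteq> [] \<and> hd ys = x \<and> last ys \<in> T \<and> set (butlast ys) \<inter> T = {} \<and> distinct ys \<and> path_edges ys \<subseteq> F"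
  using assms(1)
proof (induction rule: converse_rtrancl_induct)
  case base
  then show ?case using assms(2) by (intro exI[of _ "[t]"]) auto
next
  case (step x y)
  then obtain ys where ys: "ys \<noteq> []" "hd ys = y" "last ys \<in> T" "set (butlast ys) \<inter> T = {}" "distinct ys" "path_edges ys \<subseteq> F"
    by blast
  consider "x \<in> T" | "x \<notin> T" "x \<in> set ys" | "x \<notin> T" "x \<notin> set ys" by blast
  then show ?case
  proof cases
    case 1 then show ?thesis by (intro exI[of _ "[x]"]) auto
  next
    case 2
    then obtain as bs where s: "ys = as @ x # bs" by (meson split_list)
    have "butlast ys = as @ butlast (x # bs)" using s by (simp add: butlast_append)
    then have "set (butlast (x # bs)) \<inter> T = {}" using ys(4) by auto
    moreover have "path_edges (x # bs) \<subseteq> F" using ys(6) path_edges_append[of as x bs] s by auto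
    ultimately show ?thesis using ys s by (intro exI[of _ "x # bs"]) auto
  next
    case 3
    obtain zs where zs: "ys = y # zs" using ys(1,2) by (cases ys) auto
    show ?thesis using ys 3 step(1) zs by (intro exI[of _ "x # ys"]) auto
  qed
qed

lemma rtrancl_leaves:
  assumes "(a, b) \<in> r\<^sup>*" "a \<in> S" "b \<notin> S"
  shows "\<exists>c d. c \<in> S \<and> d \<notin> S \<and> (c, d) \<in> r"
  using assms by (induction rule: rtrancl_induct) blast+

context plane_graph
begin

text \<open>Connectivity without \<open>y\<close> gives \<open>x\<close> a second neighbour
  \<open>z\<close>; connectivity without \<open>x\<close> joins \<open>y\<close> to \<open>z\<close>
  by a path that closes up through \<open>x\<close>.\<close>

lemma biconnected_cycle:
  assumes bi: "biconnected V E" and n: "3 \<le> card V"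
  shows "\<exists>xs. gcycle xs"
proof -
  have fin: "finite V" using simple by (simp add: simple_graph_def)
  have big: "\<exists>z. z \<in> V - {a, b}" for a b
  proof (rule ccontr)
    assume "\<nexists>z. z \<in> V - {a, b}"
    then have "card V \<le> card {a, b}" by (intro card_mono) auto
    also have "\<dots> \<le> 2" by (simp add: card_insert_if)
    finally show False using n by simp
  qed
  obtain x where x: "x \<in> V" using big by blast
  obtain y0 where y0: "y0 \<in> V" "y0 \<noteq> x" using big[of x x] by blast
  have "(x, y0) \<in> {(x, y). {x, y} \<in> E}\<^sup>*"
    using bi x y0 unfolding biconnected_def graph_connected_def by blast
  then obtain y where y: "{x, y} \<in> E" using y0 by (auto elim: converse_rtranclE)
  then have yV: "y \<in> V" "y \<noteq> x" using edgeD(3)[OF y] by auto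
  obtain z0 where z0: "z0 \<in> V" "z0 \<noteq> x" "z0 \<noteq> y" using big[of x y] by blast
  have "(x, z0) \<in> {(a, b). {a, b} \<in> induced_edges E (V - {y})}\<^sup>*"
    using bi x z0 yV unfolding biconnected_def graph_connected_def by blast
  then obtain z where "{x, z} \<in> induced_edges E (V - {y})" using z0 by (auto elim: converse_rtranclE)
  then have z: "{x, z} \<in> E" "z \<noteq> y" by (auto simp: induced_edges_def)
  then have zV: "z \<in> V" "z \<noteq> x" using edgeD(3)[OF z(1)] by auto
  have "(y, z) \<in> {(a, b). {a, b} \<in> induced_edges E (V - {x})}\<^sup>*"
    using bi x zV yV unfolding biconnected_def graph_connected_def by blast
  from rtrancl_simple_path[OF this, of "{z}"] obtain ys where ys: "ys \<noteq> []" "hd ys = y" "last ys = z"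
    "distinct ys" "path_edges ys \<subseteq> induced_edges E (V - {x})" by auto
  obtain y' ys' where ys': "ys = y # y' # ys'" using ys z(2) by (cases ys rule: path_edges.cases) auto
  have xn: "x \<notin> set ys"
  proof
    assume "x \<in> set ys"
    then obtain e where "e \<in> path_edges ys" "x \<in> e" using path_edges_cover[of ys x] ys' by auto
    then show False using ys(5) by (auto simp: induced_edges_def)
  qed
  have "path_edges ys \<subseteq> E" using ys(5) by (auto simp: induced_edges_def)
  then have "gcycle (x # ys)"
    using ys(3,4) ys' xn y z by (auto simp: gcycle_def insert_commute)
  then show ?thesis by blast
qed

text \<open>Some edge leaves the cycle, say from \<open>c\<close> to \<open>d\<close>. Without
  \<open>c\<close>, the vertex \<open>d\<close> is still connected to the rest of the cycle, so the
  ear returns at a vertex other than \<open>c\<close>.\<close>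

lemma biconnected_ear:
  assumes bi: "biconnected V E" and xs: "gcycle xs" and ne: "set xs \<noteq> V"
  obtains c ys c' es where "gcycle (c # ys)" "set (c # ys) = set xs" "length (c # ys) = length xs"
    "c' \<in> set ys" "es \<noteq> []" "set es \<inter> set (c # ys) = {}" "gpath (c # es @ [c'])"
proof -
  have xsV: "set xs \<subseteq> V" using gpath_V[of xs] xs by (auto simp: gcycle_def gpath_def)
  then obtain z where z: "z \<in> V" "z \<notin> set xs" using ne by blast
  have "xs \<noteq> []" using xs by (auto simp: gcycle_def)
  then have h: "hd xs \<in> set xs" by simp
  have "(hd xs, z) \<in> {(x, y). {x, y} \<in> E}\<^sup>*"
    using bi h xsV z unfolding biconnected_def graph_connected_def by blast
  from rtrancl_leaves[OF this h z(2)] obtain c d where cd: "c \<in> set xs" "d \<notin> set xs" "{c, d} \<in> E" by auto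
  obtain ys where ys: "gcycle (c # ys)" "set (c # ys) = set xs" "length (c # ys) = length xs"
    using cycle_rotate[OF xs cd(1)] by metis
  have "ys \<noteq> []" using ys(1) by (auto simp: gcycle_def)
  then obtain t where t: "t \<in> set ys" by (cases ys) auto
  have "c \<notin> set ys" using ys(1) by (auto simp: gcycle_def)
  then have tV: "t \<in> V - {c}" using t ys(2) xsV by auto
  have dV: "d \<in> V - {c}" using edgeD(3)[OF cd(3)] by auto
  have "c \<in> V" using cd(1) xsV by blast
  then have "(d, t) \<in> {(a, b). {a, b} \<in> induced_edges E (V - {c})}\<^sup>*"
    using bi tV dV unfolding biconnected_def graph_connected_def by blast
  from rtrancl_simple_path[OF this t] obtain zs where zs: "zs \<noteq> []" "hd zs = d" "last zs \<in> set ys"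
    "set (butlast zs) \<inter> set ys = {}" "distinct zs" "path_edges zs \<subseteq> induced_edges E (V - {c})" by blast
  define es c' where "es = butlast zs" and "c' = last zs"
  have zs': "zs = es @ [c']" using zs(1) by (simp add: es_def c'_def)
  have ese: "es \<noteq> []" using zs zs' cd(2) ys(2) by (cases es) auto
  then have des: "hd es = d" using zs(2) zs' by simp
  have cn: "c \<notin> set zs"
  proof
    assume "c \<in> set zs"
    moreover have "2 \<le> length zs" using ese zs' by (cases es) auto
    ultimately obtain e where "e \<in> path_edges zs" "c \<in> e" using path_edges_cover[of zs c] by auto
    then show False using zs(6) by (auto simp: induced_edges_def)
  qed
  have "path_edges (c # zs) = insert {c, d} (path_edges zs)" using zs(1,2) by (cases zs) auto
  then have "gpath (c # zs)" using cn zs(5,6) cd(3) zs' by (auto simp: gpath_def induced_edges_def)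
  then have "gpath (c # es @ [c'])" by (simp add: zs')
  moreover have "set es \<inter> set (c # ys) = {}" using zs(4) cn zs' by (auto simp: es_def[symmetric])
  ultimately show thesis using that[OF ys(1,2,3) _ ese] zs(3) by (simp add: c'_def)
qed

end

context outer_plane_graph
begin

text \<open>\<open>theta_outer_arc\<close> puts one of the two arcs inside another cycle, and an
  inner vertex of that arc would contradict \<open>vertex_not_inside\<close>. The case
  \<open>es = []\<close> is that of a chord drawn outside.\<close>

lemma outer_ear:
  assumes c: "gcycle (c # p @ c' # q)" and P: "gpath (c # es @ [c'])"
    and es: "set es \<inter> set (c # p @ c' # q) = {}" "es \<noteq> [] \<or> p \<noteq> [] \<and> q \<noteq> []"
    and out: "trace (c # es @ [c']) \<inter> inside (curve (c # p @ [c']) (c # rev q @ [c'])) = {}"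
  shows "p = [] \<or> q = []"
proof (rule ccontr)
  assume "\<not> ?thesis"
  then have pq: "p \<noteq> []" "q \<noteq> []" by auto
  let ?A = "c # p @ [c']" and ?B = "c # rev q @ [c']" and ?P = "c # es @ [c']"
  have AB: "bigon c c' ?A ?B" by (rule cycle_arcs[OF c])
  then have gp: "gpath ?A" "gpath ?B" by (auto simp: bigon_def)
  have AP: "bigon c c' ?A ?P"
  proof (rule bigonI[OF gp(1) _ _ P])
    show "set ?A \<inter> set ?P = {c, c'}" using es(1) by auto
  qed (use pq in auto)
  have BP: "bigon c c' ?B ?P"
  proof (rule bigonI[OF gp(2) _ _ P])
    show "set ?B \<inter> set ?P = {c, c'}" using es(1) by auto
  qed (use pq in auto)
  have "trace ?A - {\<phi> c, \<phi> c'} \<subseteq> inside (trace ?B \<union> trace ?P) \<or>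
    trace ?B - {\<phi> c, \<phi> c'} \<subseteq> inside (trace ?A \<union> trace ?P)"
    by (rule theta_outer_arc[OF bigon_joined(1,2)[OF AB] bigon_joined(2)[OF AP]
      bigon_joined(3)[OF AB] bigon_joined(3)[OF AP] bigon_joined(3)[OF BP]])
      (use out in \<open>simp add: curve_def\<close>)
  then show False
  proof
    assume *: "trace ?A - {\<phi> c, \<phi> c'} \<subseteq> inside (trace ?B \<union> trace ?P)"
    have x: "hd p \<in> set ?A" "hd p \<noteq> c" "hd p \<noteq> c'" using pq c by (cases p; auto simp: gcycle_def)+
    then have V: "hd p \<in> V" "c \<in> V" "c' \<in> V" using gpath_V[OF gp(1)] by auto
    then have "\<phi> (hd p) \<in> trace ?A - {\<phi> c, \<phi> c'}" using trace_vertex[OF gp(1) V(1)] x phi_eq by auto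
    then show False using * vertex_not_inside[OF BP V(1)] by (auto simp: curve_def)
  next
    assume *: "trace ?B - {\<phi> c, \<phi> c'} \<subseteq> inside (trace ?A \<union> trace ?P)"
    have x: "hd q \<in> set ?B" "hd q \<noteq> c" "hd q \<noteq> c'" using pq c by (cases q; auto simp: gcycle_def)+
    then have V: "hd q \<in> V" "c \<in> V" "c' \<in> V" using gpath_V[OF gp(2)] by auto
    then have "\<phi> (hd q) \<in> trace ?B - {\<phi> c, \<phi> c'}" using trace_vertex[OF gp(2) V(1)] x phi_eq by auto
    then show False using * vertex_not_inside[OF AP V(1)] by (auto simp: curve_def)
  qed
qed

lemma ear_extends_cycle:
  assumes c: "gcycle (c # p @ c' # q)" and P: "gpath (c # es @ [c'])"
    and es: "set es \<inter> set (c # p @ c' # q) = {}" "es \<noteq> []"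
  shows "\<exists>xs. gcycle xs \<and> length (c # p @ c' # q) < length xs"
proof -
  let ?A = "c # p @ [c']" and ?B = "c # rev q @ [c']" and ?P = "c # es @ [c']"
  have AB: "bigon c c' ?A ?B" by (rule cycle_arcs[OF c])
  then have gp: "gpath ?A" "gpath ?B" by (auto simp: bigon_def)
  have AP: "bigon c c' ?A ?P" by (rule bigonI[OF gp(1) _ _ P]) (use es in auto)
  have BP: "bigon c c' ?B ?P" by (rule bigonI[OF gp(2) _ _ P]) (use es in auto)
  let ?C = "curve ?A ?B"
  \<comment> \<open>An ear that enters the inside stays there between its ends, and its inner
    vertices would be inside too.\<close>
  have "trace ?P \<inter> inside ?C = {}"
  proof (rule ccontr)
    assume ne: "trace ?P \<inter> inside ?C \<noteq> {}"
    have PC: "trace ?P \<inter> ?C = {\<phi> c, \<phi> c'}"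
      using bigon_joined(3)[OF AP] bigon_joined(3)[OF BP] unfolding curve_def by blast
    have "trace ?P - {\<phi> c, \<phi> c'} \<subseteq> inside ?C"
    proof (rule connected_subset_inside)
      show "connected (trace ?P - {\<phi> c, \<phi> c'})" by (rule joined_by_facts(6)[OF bigon_joined(2)[OF AP]])
      show "(trace ?P - {\<phi> c, \<phi> c'}) \<inter> ?C = {}" using PC by blast
      show "(trace ?P - {\<phi> c, \<phi> c'}) \<inter> inside ?C \<noteq> {}"
        using ne PC inside_no_overlap[of ?C] by blast
    qed
    moreover have x: "hd es \<in> set ?P" "hd es \<noteq> c" "hd es \<noteq> c'" using es P by (cases es; auto simp: gpath_def)+
    then have V: "hd es \<in> V" "c \<in> V" "c' \<in> V" using gpath_V[OF P] by auto
    then have "\<phi> (hd es) \<in> trace ?P - {\<phi> c, \<phi> c'}" using trace_vertex[OF P V(1)] x phi_eq by auto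
    ultimately show False using vertex_not_inside[OF AB V(1)] by blast
  qed
  from outer_ear[OF c P es(1) _ this] es(2) have pq: "p = [] \<or> q = []" by blast
  have dP: "distinct ?P" "path_edges ?P \<subseteq> E" using P by (auto simp: gpath_def)
  have dc: "distinct (c # p @ c' # q)" using c by (auto simp: gcycle_def)
  have len: "1 \<le> length es" using es(2) by (cases es) auto
  from pq show ?thesis
  proof
    \<comment> \<open>The ear replaces the edge from \<open>c\<close> to \<open>c'\<close> and has
      an inner vertex, so the cycle gets longer.\<close>
    assume p: "p = []"
    have "path_edges (c # es @ c' # q) = path_edges ?P \<union> path_edges (c' # q)"
      using path_edges_append[of "c # es" c' q] by simp
    moreover have "path_edges (c' # q) \<subseteq> E" using c path_edges_append[of "c # p" c' q] by (auto simp: gcycle_def)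
    moreover have "{last (c' # q), c} \<in> E" using c by (simp add: gcycle_def)
    ultimately have "gcycle (c # es @ c' # q)"
      using dP dc es len p by (auto simp: gcycle_def)
    then show ?thesis using es(2) p by (intro exI[of _ "c # es @ c' # q"]) auto
  next
    assume q: "q = []"
    have "path_edges (c # p @ c' # rev es) = path_edges ?A \<union> path_edges (c' # rev es)"
      using path_edges_append[of "c # p" c' "rev es"] by simp
    moreover have "path_edges ?A \<subseteq> E" using gp by (auto simp: gpath_def)
    moreover have Pe: "path_edges ?P = insert {c, hd es} (path_edges (es @ [c']))" using es(2) by (cases es) auto
    moreover have "path_edges (c' # rev es) = path_edges (es @ [c'])" using path_edges_rev[of "es @ [c']"] by simp
    moreover have "last (c # p @ c' # rev es) = hd es" using es(2) by (simp add: last_rev)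
    moreover have "distinct (c # p @ c' # rev es)" "3 \<le> length (c # p @ c' # rev es)" using dP dc es len by auto
    moreover have "{hd es, c} = {c, hd es}" by blast
    ultimately have "gcycle (c # p @ c' # rev es)" using dP(2) by (simp add: gcycle_def)
    then show ?thesis using es(2) q by (intro exI[of _ "c # p @ c' # rev es"]) auto
  qed
qed

lemma hamiltonian_cycle:
  assumes bi: "biconnected V E" and n: "3 \<le> card V"
  shows "\<exists>xs. gcycle xs \<and> set xs = V"
proof -
  have fin: "finite V" using simple by (simp add: simple_graph_def)
  have bound: "length xs \<le> card V" if "gcycle xs" for xs
  proof -
    have "gpath xs" using that by (auto simp: gcycle_def gpath_def)
    then have "card (set xs) \<le> card V" using gpath_V fin card_mono by blast
    then show ?thesis using that by (simp add: gcycle_def distinct_card)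
  qed
  obtain xs0 where "gcycle xs0" using biconnected_cycle[OF bi n] by blast
  then have "\<exists>xs. gcycle xs \<and> (\<forall>ys. gcycle ys \<longrightarrow> length ys \<le> length xs)"
    by (rule ex_has_greatest_nat[where b = "Suc (card V)"]) (simp add: bound less_Suc_eq_le)
  then obtain xs where xs: "gcycle xs" "\<And>ys. gcycle ys \<Longrightarrow> length ys \<le> length xs" by blast
  have "set xs = V"
  proof (rule ccontr)
    assume ne: "set xs \<noteq> V"
    obtain c ys c' es where e: "gcycle (c # ys)" "set (c # ys) = set xs" "length (c # ys) = length xs"
      "c' \<in> set ys" "es \<noteq> []" "set es \<inter> set (c # ys) = {}" "gpath (c # es @ [c'])"
      by (rule biconnected_ear[OF bi xs(1) ne])
    obtain p q where ys: "ys = p @ c' # q" using split_list[OF e(4)] by blast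
    obtain zs where "gcycle zs" "length (c # ys) < length zs"
      using ear_extends_cycle[OF e(1)[unfolded ys] e(7) e(6)[unfolded ys] e(5)] ys by blast
    then show False using xs(2)[of zs] e(3) by simp
  qed
  then show ?thesis using xs by blast
qed

end

context triangulated_plane_graph
begin

text \<open>The edge that closes the Hamiltonian cycle serves as root edge. An edge missing from
  \<open>edges_within\<close> would be a chord that avoids the inside; both arcs between its ends
  have inner vertices, against \<open>outer_ear\<close>.\<close>

lemma ex_rooted_mop:
  assumes bi: "biconnected V E" and n: "3 \<le> card V"
  shows "\<exists>u v L. rooted_mop u v V E L"
proof -
  obtain xs where xs: "gcycle xs" "set xs = V" using hamiltonian_cycle[OF bi n] by blast
  let ?u = "hd xs" and ?v = "last xs"
  have uv: "{?u, ?v} \<in> E" using xs(1) by (simp add: gcycle_def insert_commute)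
  have g: "gpath xs" using xs(1) by (auto simp: gcycle_def gpath_def)
  have ce: "curve [?u, ?v] xs = \<Union> (im ` cycle_edges xs)"
    unfolding curve_edges cycle_edges_def by (simp add: insert_commute)
  have "edges_within ?u ?v xs = E"
  proof (intro equalityI subsetI)
    fix e assume "e \<in> edges_within ?u ?v xs"
    then show "e \<in> E" using uv g unfolding edges_within_def gpath_def by blast
  next
    fix e assume e: "e \<in> E"
    show "e \<in> edges_within ?u ?v xs"
    proof (rule ccontr)
      assume n: "e \<notin> edges_within ?u ?v xs"
      then have nc: "e \<notin> cycle_edges xs" unfolding edges_within_def cycle_edges_def by (auto simp: insert_commute)
      obtain a b where ab: "e = {a, b}" "a \<noteq> b" "a \<in> V" "b \<in> V"
        using edgeD(2)[OF e] edgeD(1)[OF e] by (metis card_2_iff insert_subset)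
      obtain ys where ys: "gcycle (a # ys)" "set (a # ys) = set xs" "cycle_edges (a # ys) = cycle_edges xs"
        using cycle_rotate[OF xs(1), of a] xs(2) ab by metis
      have "b \<in> set ys" using ab ys(2) xs(2) by auto
      then obtain p q where pq: "ys = p @ b # q" by (meson split_list)
      have c: "gcycle (a # p @ b # q)" using ys(1) pq by simp
      have nc': "e \<notin> cycle_edges (a # p @ b # q)" using nc ys(3) pq by simp
      have "p \<noteq> []"
      proof
        assume "p = []"
        then show False using nc' ab(1) by (simp add: cycle_edges_def)
      qed
      moreover have "q \<noteq> []"
      proof
        assume "q = []"
        moreover have "e = {b, a}" using ab(1) by blast
        ultimately show False using nc' by (simp add: cycle_edges_def)
      qed
      moreover have "curve (a # p @ [b]) (a # rev q @ [b]) = curve [?u, ?v] xs"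
        unfolding curve_edges[of "a # p @ [b]"] cycle_arcs(2)[OF c] ce using ys(3) pq by simp
      then have "trace (a # [] @ [b]) \<inter> inside (curve (a # p @ [b]) (a # rev q @ [b])) = {}"
        using n e ab unfolding edges_within_def by (simp add: trace_edge)
      ultimately show False
        using outer_ear[OF c, of "[]"] e ab by (simp add: gpath_edge)
    qed
  qed
  then show ?thesis using triangulate[OF g refl refl uv] xs(2) by auto
qed

end

lemma maximal_outerplanar_rooted_mop:
  assumes "maximal_outerplanar V E" "3 \<le> card V"
  shows "\<exists>u v L. rooted_mop u v V E L"
proof -
  obtain \<phi> \<gamma> where *: "simple_graph V E" "biconnected V E" "plane_embedding V E \<phi> \<gamma>"
    "\<phi> ` V \<subseteq> frontier (outside (drawing V E \<phi> \<gamma>))"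
    "\<forall>F \<in> components (- drawing V E \<phi> \<gamma>). bounded F \<longrightarrow> triangle_face E \<gamma> F"
    using assms(1) unfolding maximal_outerplanar_def by blast
  interpret triangulated_plane_graph V E \<phi> \<gamma> by unfold_locales (use * in auto)
  show ?thesis by (rule ex_rooted_mop[OF *(2) assms(2)])
qed

theorem theorem1p3:
  fixes V :: "'a set" and E :: "'a set set" and n n2 :: nat
  assumes "maximal_outerplanar V E"
    and "n = card V" and "n \<ge> 5"
    and "n2 = card {v \<in> V. vertex_degree E v = 2}"
  shows "(real n2 \<le> real n / 3 \<longrightarrow> real (iota1 V E) \<le> (real n + real n2) / 6) \<and>
         (\<not> real n2 \<le> real n / 3 \<longrightarrow> real (iota1 V E) \<le> (real n - real n2) / 3)"
proof -
  obtain u v L where "rooted_mop u v V E L"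
    using maximal_outerplanar_rooted_mop[OF assms(1)] assms(2,3) by auto
  then have "6 * iota1 V E \<le> n + n2 \<and> 3 * iota1 V E + n2 \<le> n"
    using rooted_mop_iota1[of u v V E L n2] assms(2-4) by simp
  then have "6 * real (iota1 V E) \<le> real n + real n2" "3 * real (iota1 V E) + real n2 \<le> real n"
    by linarith+
  then show ?thesis by simp
qed

end
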